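(* Let $\delta,\kappa\in\{1,i\}$ and $a\in\mathbb{R}$. If $w$ is a solution of the sinh-Gordon type equation $$w_{xx}-\delta^2w_{yy}=\frac{2a}{\kappa}\sinh(2\kappa w)$$ of the form $$\tanh\left(\kappa\frac{w(x,y)}{2}\right)=\kappa F(x)G(y),$$ then the functions $F(x)$ and $G(y)$ satisfy the differential equations $$F'(x)^2=A\kappa^2\delta^2F(x)^4+BF(x)^2+C,$$ $$G'(y)^2=\kappa^2\delta^2C\,G(y)^4+\delta^2(B-4a)G(y)^2+A,$$ where $A,B,C\in\mathbb{R}$ are constants.
   Context: Here $i$ is the imaginary unit, $w=w(x,y)$ is a function of two real variables, $F$ is a function of $x$ only and $G$ is a function of $y$ only. For $\kappa=1$ the right-hand side of the PDE is $2a\sinh(2w)$ and for $\kappa=i$ it is $2a\sin(2w)$; $\delta^2=1$ gives the wave operator and $\delta^2=-1$ the Laplace operator. The paper introduces $F$ and $G$ by writing the separated ansatz $\tanh(\kappa w/2)=\kappa e^{-2(\mathcal{A}(x)+\mathcal{B}(y))}$ as $\kappa F(x)G(y)$, with $\mathcal{A}$ a function of $x$ and $\mathcal{B}$ a function of $y$ (not to be confused with the constants $A,B$). *)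

theory Defs
  imports "HOL-Analysis.Analysis"
begin

definition partial_x :: "(real \<Rightarrow> real \<Rightarrow> real) \<Rightarrow> real \<Rightarrow> real \<Rightarrow> real" where
  "partial_x w x y = deriv (\<lambda>s. w s y) x"

definition partial_y :: "(real \<Rightarrow> real \<Rightarrow> real) \<Rightarrow> real \<Rightarrow> real \<Rightarrow> real" where
  "partial_y w x y = deriv (\<lambda>t. w x t) y"

text \<open>
  Classical solutions on an open set \<open>\<Omega>\<close> of the plane. Since \<^const>\<open>deriv\<close> is total,
  the existence of the second-order partial derivatives occurring in the equation is
  required explicitly; their continuity is not, so every \<open>C\<^sup>2\<close> solution is covered.
  The parameters \<open>\<delta>\<close> and \<open>\<kappa>\<close> are complex (they may be the imaginary unit), so the equation
  is an equation of complex numbers although \<open>w\<close> is real-valued.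
\<close>

definition sinh_Gordon_solution ::
  "complex \<Rightarrow> complex \<Rightarrow> real \<Rightarrow> (real \<times> real) set \<Rightarrow> (real \<Rightarrow> real \<Rightarrow> real) \<Rightarrow> bool" where
  "sinh_Gordon_solution \<delta> \<kappa> a \<Omega> w \<longleftrightarrow>
     (\<forall>(x, y)\<in>\<Omega>.
        (\<lambda>s. w s y) differentiable (at x) \<and>
        (\<lambda>s. partial_x w s y) differentiable (at x) \<and>
        (\<lambda>t. w x t) differentiable (at y) \<and>
        (\<lambda>t. partial_y w x t) differentiable (at y) \<and>
        of_real (partial_x (partial_x w) x y) - \<delta>\<^sup>2 * of_real (partial_y (partial_y w) x y)
          = 2 * of_real a / \<kappa> * sinh (2 * \<kappa> * of_real (w x y)))"

text \<open>
  The separated form \<open>tanh (\<kappa> w / 2) = \<kappa> F(x) G(y)\<close> on \<open>\<Omega>\<close>. The nonvanishing of \<open>cosh\<close> says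
  that the left-hand side is defined: for imaginary \<open>\<kappa>\<close> it is a tangent, which has poles, and
  \<open>tanh\<close> takes the value 0 there because of division by zero. The last conjunct excludes
  the trivial case where \<open>F(x) G(y)\<close> vanishes identically: then one factor could be
  zero and the other arbitrary. It holds for factors of the form \<open>F = exp (- 2 \<A>)\<close>,
  \<open>G = exp (- 2 \<B>)\<close>, but the factors are also allowed to have zeros.
\<close>

definition separated_form ::
  "complex \<Rightarrow> (real \<times> real) set \<Rightarrow> (real \<Rightarrow> real \<Rightarrow> real) \<Rightarrow> (real \<Rightarrow> real) \<Rightarrow> (real \<Rightarrow> real) \<Rightarrow> bool" where
  "separated_form \<kappa> \<Omega> w F G \<longleftrightarrow>
     (\<forall>(x, y)\<in>\<Omega>.
        cosh (\<kappa> * of_real (w x y) / 2) \<noteq> 0 \<and>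
        tanh (\<kappa> * of_real (w x y) / 2) = \<kappa> * of_real (F x) * of_real (G y)) \<and>
     (\<exists>(x, y)\<in>\<Omega>. F x * G y \<noteq> 0)"

end

theory Submission
  imports Defs
begin

text \<open>
  With \<open>\<sigma> = \<kappa>\<^sup>2\<close> and \<open>\<epsilon> = \<delta>\<^sup>2\<close> the equation for \<open>w\<close> becomes, after division by \<open>F G\<close>, a relation
  \<open>P - Q + \<sigma> G\<^sup>2 R - \<sigma> F\<^sup>2 S - 4 a - 4 a \<sigma> F\<^sup>2 G\<^sup>2 = 0\<close> in which \<open>P = F''/F\<close> and
  \<open>R = 2 F'\<^sup>2 - F F''\<close> depend on \<open>x\<close> only and \<open>Q = \<epsilon> G''/G\<close> and \<open>S = \<epsilon> (2 G'\<^sup>2 - G G'')\<close>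
  on \<open>y\<close> only. Evaluating it at two points with different \<open>G\<^sup>2\<close> shows that \<open>P\<close> is affine
  in \<open>F\<^sup>2\<close>, so \<open>F'' = 2 \<alpha> F\<^sup>3 + \<beta> F\<close>, and likewise for \<open>G\<close>; the first integrals of these
  equations are the asserted ones, and inserting them in the relation links their coefficients.
  If \<open>G\<close> is constant, the relation is a linear equation for \<open>F'\<^sup>2\<close> as a function of \<open>F\<^sup>2\<close>.

  This argument is local: it works on rectangles in \<open>\<Omega>\<close> on which neither \<open>F\<close> nor \<open>G\<close> vanishes
  identically. Uniqueness for \<open>F'' = 2 \<alpha> F\<^sup>3 + \<beta> F\<close> implies that a function constant on a
  subinterval is constant, which carries nonvanishing, constancy and the constants
  \<open>A\<close>, \<open>B\<close>, \<open>C\<close> from rectangle to rectangle through the connected set \<open>\<Omega>\<close>.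
\<close>

section \<open>The second-order equation and its first integral\<close>

text \<open>Gronwall in both directions: to the right of \<open>x0\<close> the product
  \<open>h x * exp (- K * x)\<close> is nonincreasing, so it stays at most 0, and
  \<open>nonneg\<close> at \<open>x1\<close> leaves only 0. To the left the sign in the exponent is
  reversed.\<close>

lemma gronwall_zero:
  fixes h h' :: "real \<Rightarrow> real"
  assumes der: "\<And>x. x \<in> closed_segment x0 x1 \<Longrightarrow> (h has_real_derivative h' x) (at x)"
    and bound: "\<And>x. x \<in> closed_segment x0 x1 \<Longrightarrow> \<bar>h' x\<bar> \<le> K * h x"
    and nonneg: "h x1 \<ge> 0" and "h x0 = 0"
  shows "h x1 = 0"
proof (cases "x0 \<le> x1")
  case True
  have "h x1 * exp (- K * x1) \<le> h x0 * exp (- K * x0)"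
  proof (rule DERIV_nonpos_imp_nonincreasing[OF True, where f = "\<lambda>x. h x * exp (- K * x)"])
    fix x assume "x0 \<le> x" "x \<le> x1"
    then have x: "x \<in> closed_segment x0 x1" using True by (simp add: closed_segment_eq_real_ivl)
    have "((\<lambda>x. h x * exp (- K * x)) has_real_derivative (h' x - K * h x) * exp (- K * x)) (at x)"
      by (auto intro!: derivative_eq_intros der[OF x] simp: algebra_simps)
    moreover have "(h' x - K * h x) * exp (- K * x) \<le> 0"
      using bound[OF x] by (intro mult_nonpos_nonneg) auto
    ultimately show "\<exists>y. ((\<lambda>x. h x * exp (- K * x)) has_real_derivative y) (at x) \<and> y \<le> 0"
      by blast
  qed
  with assms show ?thesis by (simp add: mult_le_0_iff)
next
  case False
  have "h x1 * exp (K * x1) \<le> h x0 * exp (K * x0)"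
  proof (rule DERIV_nonneg_imp_nondecreasing[where f = "\<lambda>x. h x * exp (K * x)"])
    show "x1 \<le> x0" using False by simp
  next
    fix x assume "x1 \<le> x" "x \<le> x0"
    then have x: "x \<in> closed_segment x0 x1" using False by (simp add: closed_segment_eq_real_ivl)
    have "((\<lambda>x. h x * exp (K * x)) has_real_derivative (h' x + K * h x) * exp (K * x)) (at x)"
      by (auto intro!: derivative_eq_intros der[OF x] simp: algebra_simps)
    moreover have "(h' x + K * h x) * exp (K * x) \<ge> 0"
      using bound[OF x] by (intro mult_nonneg_nonneg) auto
    ultimately show "\<exists>y. ((\<lambda>x. h x * exp (K * x)) has_real_derivative y) (at x) \<and> y \<ge> 0"
      by blast
  qed
  with assms show ?thesis by (simp add: mult_le_0_iff)
qed

text \<open>Uniqueness of the constant solution through an equilibrium: Gronwall is applied to the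
  squared phase-plane distance \<open>h\<close>. The cubic is only locally Lipschitz, so the
  Gronwall constant uses a bound \<open>M\<close> for \<open>F\<close> on the compact
  segment.\<close>

lemma cubic_ode_equilibrium:
  fixes F F' :: "real \<Rightarrow> real"
  assumes "convex I"
    and dF: "\<And>x. x \<in> I \<Longrightarrow> (F has_real_derivative F' x) (at x)"
    and dF': "\<And>x. x \<in> I \<Longrightarrow> (F' has_real_derivative 2 * \<alpha> * F x ^ 3 + \<beta> * F x) (at x)"
    and x0: "x0 \<in> I" "F' x0 = 0" "2 * \<alpha> * F x0 ^ 3 + \<beta> * F x0 = 0"
    and "x1 \<in> I"
  shows "F x1 = F x0"
proof -
  let ?S = "closed_segment x0 x1" and ?c = "F x0"
  have sub: "?S \<subseteq> I" using assms by (simp add: closed_segment_subset)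
  have "continuous_on ?S F"
    using sub dF by (meson DERIV_continuous_on has_field_derivative_at_within subsetD)
  then have "bounded (F ` ?S)"
    by (intro compact_imp_bounded compact_continuous_image) auto
  then obtain M where M: "\<And>x. x \<in> ?S \<Longrightarrow> \<bar>F x\<bar> \<le> M"
    by (force simp: bounded_iff)
  \<comment> \<open>As \<open>?c\<close> is a root of the cubic, the right-hand side factors as
    \<open>(F x - ?c) * (q x - 1)\<close>. The summand 1 in \<open>q\<close> absorbs the derivative
    of \<open>(F x - ?c)\<^sup>2\<close>, so \<open>q\<close> is a common factor of the derivative
    of \<open>h\<close>.\<close>
  define q where "q x = 1 + 2 * \<alpha> * (F x ^ 2 + F x * ?c + ?c ^ 2) + \<beta>" for x
  define h where "h x = (F x - ?c)\<^sup>2 + (F' x)\<^sup>2" for x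
  have "h x1 = 0"
  proof (rule gronwall_zero[where h = h and ?x0.0 = x0 and ?x1.0 = x1 and h' = "\<lambda>x. 2 * ((F x - ?c) * F' x) * q x"
        and K = "1 + 2 * \<bar>\<alpha>\<bar> * (3 * (M * M)) + \<bar>\<beta>\<bar>"])
    fix x assume x: "x \<in> ?S"
    have F2: "2 * \<alpha> * F x ^ 3 + \<beta> * F x = (F x - ?c) * (q x - 1)"
      using x0(3) unfolding q_def by (simp add: algebra_simps power2_eq_square power3_eq_cube)
    show "(h has_real_derivative 2 * ((F x - ?c) * F' x) * q x) (at x)"
      unfolding h_def using dF[of x] dF'[of x] x sub unfolding F2
      by (auto intro!: derivative_eq_intros simp: algebra_simps)
    have prod: "\<bar>u * v\<bar> \<le> M * M" if "\<bar>u\<bar> \<le> M" "\<bar>v\<bar> \<le> M" for u v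
      unfolding abs_mult using that by (intro mult_mono) auto
    have "\<bar>F x * F x\<bar> \<le> M * M" "\<bar>F x * ?c\<bar> \<le> M * M" "\<bar>?c * ?c\<bar> \<le> M * M"
      using M[OF x] M[of x0] by (intro prod; simp)+
    then have "\<bar>F x ^ 2 + F x * ?c + ?c ^ 2\<bar> \<le> 3 * (M * M)"
      unfolding power2_eq_square by linarith
    then have "\<bar>2 * \<alpha> * (F x ^ 2 + F x * ?c + ?c ^ 2)\<bar> \<le> 2 * \<bar>\<alpha>\<bar> * (3 * (M * M))"
      unfolding abs_mult by (intro mult_mono) auto
    then have q: "\<bar>q x\<bar> \<le> 1 + 2 * \<bar>\<alpha>\<bar> * (3 * (M * M)) + \<bar>\<beta>\<bar>"
      unfolding q_def by linarith
    have "\<bar>2 * ((F x - ?c) * F' x)\<bar> \<le> h x"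
      using sum_squares_bound[of "\<bar>F x - ?c\<bar>" "\<bar>F' x\<bar>"] by (simp add: h_def abs_mult)
    then show "\<bar>2 * ((F x - ?c) * F' x) * q x\<bar> \<le> (1 + 2 * \<bar>\<alpha>\<bar> * (3 * (M * M)) + \<bar>\<beta>\<bar>) * h x"
      unfolding abs_mult[of _ "q x"] mult.commute[of _ "h x"] by (intro mult_mono q) (auto simp: h_def)
  qed (auto simp: h_def x0)
  then show ?thesis by (simp add: h_def sum_power2_eq_zero_iff)
qed

lemma DERIV_zero_if_locally_constant:
  fixes F :: "real \<Rightarrow> real"
  assumes "open I" "x \<in> I" "\<And>z. z \<in> I \<Longrightarrow> F z = c" "(F has_real_derivative D) (at x)"
  shows "D = 0"
proof -
  have "(F has_real_derivative 0) (at x)"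
    by (rule has_field_derivative_transform_within_open[where f = "\<lambda>_. c" and S = I])
      (use assms in auto)
  then show ?thesis using assms(4) DERIV_unique by blast
qed

text \<open>On the open set \<open>I'\<close> both \<open>F'\<close> and its derivative vanish, so
  each point there is an equilibrium to which \<open>cubic_ode_equilibrium\<close> applies.\<close>

lemma cubic_ode_constant_on:
  fixes F F' :: "real \<Rightarrow> real"
  assumes "convex I"
    and dF: "\<And>x. x \<in> I \<Longrightarrow> (F has_real_derivative F' x) (at x)"
    and dF': "\<And>x. x \<in> I \<Longrightarrow> (F' has_real_derivative 2 * \<alpha> * F x ^ 3 + \<beta> * F x) (at x)"
    and "open I'" "I' \<noteq> {}" "I' \<subseteq> I" "F constant_on I'"
  shows "F constant_on I"
proof -
  obtain c where c: "\<And>x. x \<in> I' \<Longrightarrow> F x = c" using assms unfolding constant_on_def by blast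
  have F': "F' x = 0" if "x \<in> I'" for x
    by (rule DERIV_zero_if_locally_constant[OF assms(4) that c dF]) (use that assms(6) in auto)
  obtain x0 where x0: "x0 \<in> I'" "x0 \<in> I" using assms(5,6) by blast
  have eq: "2 * \<alpha> * F x0 ^ 3 + \<beta> * F x0 = 0"
    by (rule DERIV_zero_if_locally_constant[OF assms(4) x0(1) F' dF'[OF x0(2)]])
  have "F x = F x0" if "x \<in> I" for x
    by (rule cubic_ode_equilibrium[where F = F and F' = F', OF assms(1) dF dF' x0(2) F'[OF x0(1)] eq that])
  then show ?thesis unfolding constant_on_def by blast
qed

lemma derivative_zero_constant:
  fixes h :: "real \<Rightarrow> real"
  assumes "convex I" "\<And>x. x \<in> I \<Longrightarrow> (h has_real_derivative 0) (at x)"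
  obtains k where "\<And>x. x \<in> I \<Longrightarrow> h x = k"
proof -
  have "\<exists>k. \<forall>x\<in>I. h x = k"
    by (rule has_field_derivative_zero_constant[OF assms(1)])
      (rule has_field_derivative_at_within[OF assms(2)])
  then show ?thesis using that by blast
qed

text \<open>The second-order equation accompanies its first integral because the latter alone does
  not give uniqueness: for \<open>F'\<^sup>2 = 1 - F\<^sup>2\<close>, sine can be continued by the
  constant 1 beyond a maximum.\<close>

definition elliptic_ode :: "real \<Rightarrow> real \<Rightarrow> real \<Rightarrow> (real \<Rightarrow> real) \<Rightarrow> (real \<Rightarrow> real) \<Rightarrow> real set \<Rightarrow> bool" where
  "elliptic_ode \<alpha> \<beta> \<gamma> F F' I \<longleftrightarrow> (\<forall>x\<in>I. (F has_real_derivative F' x) (at x)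
     \<and> (F' has_real_derivative 2 * \<alpha> * F x ^ 3 + \<beta> * F x) (at x)
     \<and> (F' x)\<^sup>2 = \<alpha> * F x ^ 4 + \<beta> * (F x)\<^sup>2 + \<gamma>)"

text \<open>Multiplying the second-order equation by \<open>2 * F' x\<close> makes it integrable;
  \<open>\<gamma>\<close> is the constant of integration.\<close>

lemma elliptic_odeI_second_order:
  fixes F F' :: "real \<Rightarrow> real"
  assumes "convex I"
    and dF: "\<And>x. x \<in> I \<Longrightarrow> (F has_real_derivative F' x) (at x)"
    and dF': "\<And>x. x \<in> I \<Longrightarrow> (F' has_real_derivative 2 * \<alpha> * F x ^ 3 + \<beta> * F x) (at x)"
  shows "\<exists>\<gamma>. elliptic_ode \<alpha> \<beta> \<gamma> F F' I"
proof -
  have "((\<lambda>x. (F' x)\<^sup>2 - \<alpha> * F x ^ 4 - \<beta> * (F x)\<^sup>2) has_real_derivative 0) (at x)" if "x \<in> I" for x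
    by (rule derivative_eq_intros dF[OF that] dF'[OF that] refl)+
      (simp add: algebra_simps eval_nat_numeral)
  then obtain \<gamma> where "\<And>x. x \<in> I \<Longrightarrow> (F' x)\<^sup>2 - \<alpha> * F x ^ 4 - \<beta> * (F x)\<^sup>2 = \<gamma>"
    using derivative_zero_constant[OF assms(1)] by (metis (no_types, lifting))
  then have "elliptic_ode \<alpha> \<beta> \<gamma> F F' I"
    unfolding elliptic_ode_def using dF dF' by force
  then show ?thesis ..
qed

section \<open>Uniqueness of the coefficients of the first integral\<close>

lemma quadratic_three_roots:
  fixes p q r :: real
  assumes "p * u\<^sup>2 + q * u + r = 0" "p * v\<^sup>2 + q * v + r = 0" "p * z\<^sup>2 + q * z + r = 0"
    and "u \<noteq> v" "v \<noteq> z" "u \<noteq> z"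
  shows "p = 0" "q = 0" "r = 0"
proof -
  have "(u - v) * (p * (u + v) + q) = 0" "(u - z) * (p * (u + z) + q) = 0"
    using assms by (simp_all add: algebra_simps power2_eq_square)
  then have uv: "p * (u + v) + q = 0" "p * (u + z) + q = 0" using assms by auto
  then have "p * (v - z) = 0" unfolding right_diff_distrib distrib_left by linarith
  then show p: "p = 0" using assms by auto
  then show q: "q = 0" using uv by simp
  show "r = 0" using p q assms by simp
qed

lemma constant_on_if_square_constant_on:
  fixes F :: "real \<Rightarrow> real"
  assumes "connected I" "continuous_on I F" "\<And>x. x \<in> I \<Longrightarrow> (F x)\<^sup>2 = c"
  shows "F constant_on I"
proof -
  have "F x = sqrt c \<or> F x = - sqrt c" if "x \<in> I" for x
    using assms(3)[OF that] by (metis abs_eq_iff' real_sqrt_abs)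
  then have "F ` I \<subseteq> {sqrt c, - sqrt c}" by blast
  then have "finite (F ` I)" by (rule finite_subset) simp
  then show ?thesis by (rule continuous_finite_range_constant[OF assms(1,2)])
qed

text \<open>The difference of the two first integrals is a polynomial of degree at most two in
  \<open>F\<^sup>2\<close>. A nonconstant \<open>F\<close> gives \<open>F\<^sup>2\<close> three
  distinct values, so the polynomial is zero.\<close>

lemma elliptic_ode_unique:
  assumes "elliptic_ode \<alpha> \<beta> \<gamma> F F' I" "elliptic_ode \<alpha>' \<beta>' \<gamma>' F F' I"
    and "connected I" "\<not> F constant_on I"
  shows "\<alpha> = \<alpha>'" "\<beta> = \<beta>'" "\<gamma> = \<gamma>'"
proof -
  have cont: "continuous_on I F"
    using assms(1) unfolding elliptic_ode_def
    by (meson DERIV_continuous_on has_field_derivative_at_within)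
  then have conn: "connected ((\<lambda>x. (F x)\<^sup>2) ` I)"
    using assms(3) by (intro connected_continuous_image continuous_intros)
  obtain x y where xy: "x \<in> I" "y \<in> I" "(F x)\<^sup>2 < (F y)\<^sup>2"
    using constant_on_if_square_constant_on[OF assms(3) cont] assms(4)
    by (metis linorder_less_linear)
  \<comment> \<open>The third value is the midpoint of two others, attained because the image of
    \<open>I\<close> under \<open>F\<^sup>2\<close> is connected.\<close>
  let ?v = "((F x)\<^sup>2 + (F y)\<^sup>2) / 2"
  have "?v \<in> (\<lambda>x. (F x)\<^sup>2) ` I"
    using connectedD_interval[OF conn, of "(F x)\<^sup>2" "(F y)\<^sup>2" ?v] xy by auto
  then obtain z where z: "z \<in> I" "(F z)\<^sup>2 = ?v" by auto
  have eq: "(\<alpha> - \<alpha>') * ((F t)\<^sup>2)\<^sup>2 + (\<beta> - \<beta>') * (F t)\<^sup>2 + (\<gamma> - \<gamma>') = 0" if "t \<in> I" for t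
    using assms(1,2) that unfolding elliptic_ode_def
    by (force simp: algebra_simps simp flip: power_mult)
  have "(F x)\<^sup>2 \<noteq> (F z)\<^sup>2" "(F z)\<^sup>2 \<noteq> (F y)\<^sup>2" "(F x)\<^sup>2 \<noteq> (F y)\<^sup>2"
    using z xy by auto
  note * = quadratic_three_roots[OF eq[OF xy(1)] eq[OF z(1)] eq[OF xy(2)] this]
  show "\<alpha> = \<alpha>'" "\<beta> = \<beta>'" "\<gamma> = \<gamma>'" using * by auto
qed

section \<open>Separation on a rectangle\<close>

text \<open>The equation for \<open>w\<close>, written in terms of \<open>F\<close> and \<open>G\<close> with \<open>\<sigma> = \<kappa>\<^sup>2\<close> and \<open>\<epsilon> = \<delta>\<^sup>2\<close>,
  and with denominators cleared.\<close>

definition separated_pde ::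
  "real \<Rightarrow> real \<Rightarrow> real \<Rightarrow> real \<Rightarrow> real \<Rightarrow> real \<Rightarrow> real \<Rightarrow> real \<Rightarrow> real \<Rightarrow> bool" where
  "separated_pde \<sigma> \<epsilon> a f f1 f2 g g1 g2 \<longleftrightarrow>
     1 - \<sigma> * (f * g)\<^sup>2 \<noteq> 0 \<and>
     (1 - \<sigma> * (f * g)\<^sup>2) * (f2 * g - \<epsilon> * (f * g2)) + 2 * \<sigma> * (f * g) * ((f1 * g)\<^sup>2 - \<epsilon> * (f * g1)\<^sup>2)
       = 4 * a * (f * g) * (1 + \<sigma> * (f * g)\<^sup>2)"

text \<open>Multiplying by \<open>- \<epsilon>\<close> restores the shape of the equation after
  exchanging the variables, since \<open>\<epsilon>\<close> squares to 1; the right-hand side then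
  carries \<open>- (\<epsilon> * a)\<close>.\<close>

lemma separated_pde_swap:
  assumes "\<epsilon> * \<epsilon> = 1" "separated_pde \<sigma> \<epsilon> a f f1 f2 g g1 g2"
  shows "separated_pde \<sigma> \<epsilon> (- (\<epsilon> * a)) g g1 g2 f f1 f2"
proof -
  have "\<epsilon> * ((1 - \<sigma> * (f * g)\<^sup>2) * (f2 * g - \<epsilon> * (f * g2))
      + 2 * \<sigma> * (f * g) * ((f1 * g)\<^sup>2 - \<epsilon> * (f * g1)\<^sup>2)) = \<epsilon> * (4 * a * (f * g) * (1 + \<sigma> * (f * g)\<^sup>2))"
    using assms(2) by (simp add: separated_pde_def)
  moreover have "\<epsilon> * ((1 - \<sigma> * (f * g)\<^sup>2) * (f2 * g - \<epsilon> * (f * g2))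
      + 2 * \<sigma> * (f * g) * ((f1 * g)\<^sup>2 - \<epsilon> * (f * g1)\<^sup>2))
      = (1 - \<sigma> * (f * g)\<^sup>2) * (\<epsilon> * (f2 * g) - (\<epsilon> * \<epsilon>) * (f * g2))
      + 2 * \<sigma> * (f * g) * (\<epsilon> * (f1 * g)\<^sup>2 - (\<epsilon> * \<epsilon>) * (f * g1)\<^sup>2)"
    by (simp add: algebra_simps)
  ultimately show ?thesis
    using assms unfolding separated_pde_def by (simp add: algebra_simps)
qed

text \<open>One triple of constants serves both equations: \<open>A\<close> and \<open>C\<close> are
  each the constant term of one first integral and, up to \<open>\<sigma> * \<epsilon>\<close>, the
  quartic coefficient of the other.\<close>

definition separated_system ::
  "real \<Rightarrow> real \<Rightarrow> real \<Rightarrow> real \<Rightarrow> real \<Rightarrow> real \<Rightarrow> (real \<Rightarrow> real) \<Rightarrow> (real \<Rightarrow> real) \<Rightarrow> real set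
    \<Rightarrow> (real \<Rightarrow> real) \<Rightarrow> (real \<Rightarrow> real) \<Rightarrow> real set \<Rightarrow> bool" where
  "separated_system \<sigma> \<epsilon> a A B C F F' I G G' J \<longleftrightarrow>
     elliptic_ode (\<sigma> * \<epsilon> * A) B C F F' I \<and> elliptic_ode (\<sigma> * \<epsilon> * C) (\<epsilon> * (B - 4 * a)) A G G' J"

text \<open>Exchanging the variables exchanges \<open>A\<close> and \<open>C\<close>; the new middle
  constant inverts the map from \<open>B\<close> to \<open>\<epsilon> * (B - 4 * a)\<close>.\<close>

lemma separated_system_swap:
  assumes "\<epsilon> * \<epsilon> = 1" "separated_system \<sigma> \<epsilon> (- (\<epsilon> * a)) A B C G G' J F F' I"
  shows "separated_system \<sigma> \<epsilon> a C (\<epsilon> * B + 4 * a) A F F' I G G' J"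
proof -
  have cancel: "\<epsilon> * (\<epsilon> * z) = z" for z using assms(1) by (simp flip: mult.assoc)
  have "\<epsilon> * (B - 4 * - (\<epsilon> * a)) = \<epsilon> * B + 4 * a" "\<epsilon> * ((\<epsilon> * B + 4 * a) - 4 * a) = B"
    using cancel[of a] cancel[of B] by (simp_all add: algebra_simps)
  with assms show ?thesis unfolding separated_system_def by (simp add: cancel)
qed

text \<open>With \<open>G\<close> constant only one ordinary differential equation for
  \<open>F\<close> remains. It is linear in \<open>F1\<^sup>2\<close> as a function of
  \<open>F\<close>, with particular solution \<open>4 * a * F\<^sup>2\<close> and homogeneous
  solution \<open>m\<^sup>2\<close>.\<close>

lemma separated_system_constant_right:
  assumes "\<sigma> * \<sigma> = 1" "\<epsilon> * \<epsilon> = 1"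
    and "convex I"
    and dF: "\<And>x. x \<in> I \<Longrightarrow> (F has_real_derivative F1 x) (at x)"
    and dF1: "\<And>x. x \<in> I \<Longrightarrow> (F1 has_real_derivative F2 x) (at x)"
    and "open J" "J \<noteq> {}"
    and dG: "\<And>y. y \<in> J \<Longrightarrow> (G has_real_derivative G1 y) (at y)"
    and dG1: "\<And>y. y \<in> J \<Longrightarrow> (G1 has_real_derivative G2 y) (at y)"
    and pde: "\<And>x y. x \<in> I \<Longrightarrow> y \<in> J \<Longrightarrow> separated_pde \<sigma> \<epsilon> a (F x) (F1 x) (F2 x) (G y) (G1 y) (G2 y)"
    and const: "\<And>y. y \<in> J \<Longrightarrow> G y = g" and "g \<noteq> 0"
  shows "\<exists>A B C. separated_system \<sigma> \<epsilon> a A B C F F1 I G G1 J"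
proof -
  have G1: "G1 y = 0" if "y \<in> J" for y
    by (rule DERIV_zero_if_locally_constant[OF \<open>open J\<close> that const dG[OF that]])
  have G2: "G2 y = 0" if "y \<in> J" for y
    by (rule DERIV_zero_if_locally_constant[OF \<open>open J\<close> that G1 dG1[OF that]])
  obtain y0 where y0: "y0 \<in> J" using assms by blast
  define s where "s = \<sigma> * g\<^sup>2"
  define m where "m x = 1 - s * (F x)\<^sup>2" for x
  have m: "m x \<noteq> 0" if "x \<in> I" for x
    using pde[OF that y0] const[OF y0] by (simp add: separated_pde_def m_def s_def algebra_simps)
  have F2: "m x * F2 x = 4 * a * F x * (1 + s * (F x)\<^sup>2) - 2 * s * F x * (F1 x)\<^sup>2" if "x \<in> I" for x
  proof -
    have "g * (m x * F2 x + 2 * s * F x * (F1 x)\<^sup>2) = g * (4 * a * F x * (1 + s * (F x)\<^sup>2))"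
      using pde[OF that y0] const[OF y0] G1[OF y0] G2[OF y0]
      by (simp add: separated_pde_def m_def s_def algebra_simps power2_eq_square)
    then show ?thesis using \<open>g \<noteq> 0\<close> by simp
  qed
  \<comment> \<open>\<open>h\<close> is a first integral, found with the integrating factor \<open>1 / m\<^sup>2\<close>.\<close>
  define h where "h x = ((F1 x)\<^sup>2 - 4 * a * (F x)\<^sup>2) / (m x)\<^sup>2" for x
  have "(h has_real_derivative 0) (at x)" if "x \<in> I" for x
  proof -
    have dm: "(m has_real_derivative - (2 * s * F x * F1 x)) (at x)"
      unfolding m_def using dF[OF that] by (auto intro!: derivative_eq_intros)
    have "(h has_real_derivative
        ((2 * F1 x * F2 x - 8 * a * F x * F1 x) * (m x)\<^sup>2
          - ((F1 x)\<^sup>2 - 4 * a * (F x)\<^sup>2) * (2 * m x * - (2 * s * F x * F1 x))) / ((m x)\<^sup>2 * (m x)\<^sup>2)) (at x)"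
      unfolding h_def using m[OF that] dF[OF that] dF1[OF that] dm
      by (auto intro!: derivative_eq_intros simp: algebra_simps)
    moreover have "(2 * F1 x * F2 x - 8 * a * F x * F1 x) * (m x)\<^sup>2
          - ((F1 x)\<^sup>2 - 4 * a * (F x)\<^sup>2) * (2 * m x * - (2 * s * F x * F1 x))
      = 2 * m x * F1 x * ((m x * F2 x) - 4 * a * F x * m x + 2 * s * F x * ((F1 x)\<^sup>2 - 4 * a * (F x)\<^sup>2))"
      by (simp add: algebra_simps power2_eq_square)
    moreover have "(m x * F2 x) - 4 * a * F x * m x + 2 * s * F x * ((F1 x)\<^sup>2 - 4 * a * (F x)\<^sup>2) = 0"
      unfolding F2[OF that] by (simp add: m_def algebra_simps power2_eq_square)
    ultimately show ?thesis by simp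
  qed
  then obtain k where k: "\<And>x. x \<in> I \<Longrightarrow> h x = k"
    using derivative_zero_constant[OF \<open>convex I\<close>] by metis
  have F1: "(F1 x)\<^sup>2 = 4 * a * (F x)\<^sup>2 + k * (m x)\<^sup>2" if "x \<in> I" for x
    using k[OF that] m[OF that] by (simp add: h_def divide_simps)
  \<comment> \<open>Expanding \<open>k * (m x)\<^sup>2\<close> in powers of \<open>F x\<close> gives
    \<open>B\<close>, the constant term \<open>k\<close> in the role of \<open>C\<close>, and the
    quartic coefficient \<open>k * s\<^sup>2\<close>. The value of \<open>A\<close> produces this
    coefficient and also makes the constant \<open>g\<close> satisfy its own first integral.\<close>
  define A B where "A = \<sigma> * \<epsilon> * k * g ^ 4" and "B = 4 * a - 2 * k * s"
  have sA: "\<sigma> * \<epsilon> * A = k * s\<^sup>2"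
  proof -
    have "\<sigma> * \<epsilon> * A = (\<sigma> * \<sigma>) * (\<epsilon> * \<epsilon>) * k * g ^ 4" "s\<^sup>2 = (\<sigma> * \<sigma>) * g ^ 4"
      by (simp_all add: A_def s_def eval_nat_numeral)
    then show ?thesis by (simp add: assms)
  qed
  \<comment> \<open>This comes from the original equation by cancelling \<open>m x\<close>.
    Differentiating the first integral would leave a factor \<open>F1 x\<close>, which may
    vanish.\<close>
  have F2': "F2 x = 2 * (\<sigma> * \<epsilon> * A) * F x ^ 3 + B * F x" if "x \<in> I" for x
  proof -
    have "m x * F2 x = m x * (2 * (k * s\<^sup>2) * F x ^ 3 + B * F x)"
      unfolding F2[OF that] F1[OF that] by (simp add: m_def B_def algebra_simps eval_nat_numeral)
    then show ?thesis using m[OF that] sA by simp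
  qed
  have "elliptic_ode (\<sigma> * \<epsilon> * A) B k F F1 I"
    unfolding elliptic_ode_def
  proof (intro ballI conjI)
    fix x assume x: "x \<in> I"
    show "(F1 has_real_derivative 2 * (\<sigma> * \<epsilon> * A) * F x ^ 3 + B * F x) (at x)"
      using dF1[OF x] F2'[OF x] by simp
    show "(F1 x)\<^sup>2 = \<sigma> * \<epsilon> * A * F x ^ 4 + B * (F x)\<^sup>2 + k"
      unfolding sA F1[OF x] by (simp add: m_def B_def algebra_simps eval_nat_numeral)
  qed (rule dF)
  moreover have "elliptic_ode (\<sigma> * \<epsilon> * k) (\<epsilon> * (B - 4 * a)) A G G1 J"
    unfolding elliptic_ode_def
  proof (intro ballI conjI)
    fix y assume y: "y \<in> J"
    show "(G1 has_real_derivative 2 * (\<sigma> * \<epsilon> * k) * G y ^ 3 + \<epsilon> * (B - 4 * a) * G y) (at y)"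
      using dG1[OF y] G2[OF y] const[OF y] by (simp add: B_def s_def algebra_simps eval_nat_numeral)
    show "(G1 y)\<^sup>2 = \<sigma> * \<epsilon> * k * G y ^ 4 + \<epsilon> * (B - 4 * a) * (G y)\<^sup>2 + A"
      using G1[OF y] const[OF y] by (simp add: A_def B_def s_def algebra_simps eval_nat_numeral)
  qed (rule dG)
  ultimately show ?thesis unfolding separated_system_def by blast
qed

text \<open>Otherwise \<open>G\<close> would take at most the three values 0, \<open>G y1\<close>
  and \<open>- G y1\<close>, and a continuous function with finite range on a connected set is
  constant.\<close>

lemma nonconstant_on_nonzero:
  fixes G :: "real \<Rightarrow> real"
  assumes "connected J" "continuous_on J G" "\<not> G constant_on J"
  obtains y1 y2 where "y1 \<in> J" "y2 \<in> J" "G y1 \<noteq> 0" "G y2 \<noteq> 0" "(G y1)\<^sup>2 \<noteq> (G y2)\<^sup>2"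
proof -
  obtain y1 where y1: "y1 \<in> J" "G y1 \<noteq> 0"
    using assms(3) unfolding constant_on_def by blast
  have "\<exists>y2\<in>J. G y2 \<noteq> 0 \<and> (G y1)\<^sup>2 \<noteq> (G y2)\<^sup>2"
  proof (rule ccontr)
    assume "\<not> ?thesis"
    then have *: "G y = 0 \<or> (G y)\<^sup>2 = (G y1)\<^sup>2" if "y \<in> J" for y
      using that by metis
    then have "G ` J \<subseteq> {0, G y1, - G y1}"
      by (auto simp: power2_eq_iff)
    then have "finite (G ` J)" by (rule finite_subset) simp
    then show False using continuous_finite_range_constant[OF assms(1,2)] assms(3) by blast
  qed
  then show ?thesis using y1 that by blast
qed

text \<open>The relations at \<open>y1\<close> and \<open>y2\<close> are two linear equations for
  \<open>F2 x / F x\<close> and \<open>R\<close>, solvable because the squares of \<open>G\<close>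
  differ. The elimination is algebraic and takes no derivative of \<open>F2\<close>.\<close>

lemma cubic_from_separated_pde:
  assumes pde: "\<And>x y. x \<in> I \<Longrightarrow> y \<in> J \<Longrightarrow> separated_pde \<sigma> \<epsilon> a (F x) (F1 x) (F2 x) (G y) (G1 y) (G2 y)"
    and \<sigma>: "\<sigma> \<noteq> 0"
    and y12: "y1 \<in> J" "y2 \<in> J" "G y1 \<noteq> 0" "G y2 \<noteq> 0" "(G y1)\<^sup>2 \<noteq> (G y2)\<^sup>2"
  shows "\<exists>\<alpha> \<beta>. \<forall>x\<in>I. F2 x = 2 * \<alpha> * F x ^ 3 + \<beta> * F x"
proof -
  define Q where "Q y = \<epsilon> * G2 y / G y" for y
  define S where "S y = 2 * \<epsilon> * (G1 y)\<^sup>2 - G y * \<epsilon> * G2 y" for y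
  define d where "d = (G y1)\<^sup>2 - (G y2)\<^sup>2"
  \<comment> \<open>Subtracting the two relations cancels \<open>F2 x / F x\<close> and leaves
    \<open>\<sigma> * R = r0 + r1 * (F x)\<^sup>2\<close>.\<close>
  define r0 r1 where "r0 = (Q y1 - Q y2) / d" and "r1 = (\<sigma> * (S y1 - S y2)) / d + 4 * a * \<sigma>"
  have d: "d \<noteq> 0" using y12 by (simp add: d_def)
  have eq: "F2 x / F x - Q y + \<sigma> * (G y)\<^sup>2 * (2 * (F1 x)\<^sup>2 - F x * F2 x) - \<sigma> * (F x)\<^sup>2 * S y
      - 4 * a - 4 * a * \<sigma> * (F x)\<^sup>2 * (G y)\<^sup>2 = 0"
    if "x \<in> I" "y \<in> J" "F x \<noteq> 0" "G y \<noteq> 0" for x y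
  proof -
    have "F x * G y * (F2 x / F x - Q y + \<sigma> * (G y)\<^sup>2 * (2 * (F1 x)\<^sup>2 - F x * F2 x) - \<sigma> * (F x)\<^sup>2 * S y
      - 4 * a - 4 * a * \<sigma> * (F x)\<^sup>2 * (G y)\<^sup>2) =
      (1 - \<sigma> * (F x * G y)\<^sup>2) * (F2 x * G y - \<epsilon> * (F x * G2 y))
      + 2 * \<sigma> * (F x * G y) * ((F1 x * G y)\<^sup>2 - \<epsilon> * (F x * G1 y)\<^sup>2)
       - 4 * a * (F x * G y) * (1 + \<sigma> * (F x * G y)\<^sup>2)"
      unfolding Q_def S_def using that(3,4) by (simp add: field_simps power2_eq_square)
    then show ?thesis using pde[OF that(1,2)] that(3,4) by (simp add: separated_pde_def)
  qed
  \<comment> \<open>These are the coefficients of \<open>F2 x / F x\<close> in powers of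
    \<open>(F x)\<^sup>2\<close> after inserting \<open>R\<close> in the relation at
    \<open>y1\<close>.\<close>
  define \<beta> where "\<beta> = Q y1 - (G y1)\<^sup>2 * r0 + 4 * a"
  define \<gamma> where "\<gamma> = \<sigma> * S y1 + 4 * a * \<sigma> * (G y1)\<^sup>2 - (G y1)\<^sup>2 * r1"
  have "F2 x = 2 * (\<gamma> / 2) * F x ^ 3 + \<beta> * F x" if x: "x \<in> I" for x
  proof (cases "F x = 0")
    case True
    \<comment> \<open>At a zero of \<open>F\<close>, where division is impossible, the uncleared
      equation reduces to \<open>F2 x * G y1 = 0\<close>.\<close>
    have "F2 x = 0"
      using pde[OF x y12(1)] y12 True by (simp add: separated_pde_def)
    then show ?thesis using True by simp
  next
    case False
    define R where "R = 2 * (F1 x)\<^sup>2 - F x * F2 x"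
    note eqs = eq[OF x y12(1) False y12(3), folded R_def] eq[OF x y12(2) False y12(4), folded R_def]
    have "d * (\<sigma> * R) = (Q y1 - Q y2) + (\<sigma> * (S y1 - S y2) + 4 * a * \<sigma> * d) * (F x)\<^sup>2"
      using eqs unfolding d_def by (simp add: algebra_simps)
    also have "\<dots> = d * (r0 + r1 * (F x)\<^sup>2)"
      unfolding r0_def r1_def using d by (simp add: field_simps)
    finally have R: "\<sigma> * R = r0 + r1 * (F x)\<^sup>2" using d by simp
    have "F2 x / F x = Q y1 - (G y1)\<^sup>2 * (\<sigma> * R) + \<sigma> * (F x)\<^sup>2 * S y1 + 4 * a
      + 4 * a * \<sigma> * (F x)\<^sup>2 * (G y1)\<^sup>2"
      using eqs(1) by (simp add: algebra_simps)
    also have "\<dots> = \<beta> + \<gamma> * (F x)\<^sup>2"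
      unfolding R \<beta>_def \<gamma>_def by (simp add: algebra_simps)
    finally show ?thesis using False by (simp add: field_simps eval_nat_numeral)
  qed
  then show ?thesis by blast
qed

lemma bilinear_four_points:
  fixes p q r s :: real
  assumes "p + q * u1 + r * v1 + s * (u1 * v1) = 0" "p + q * u1 + r * v2 + s * (u1 * v2) = 0"
    "p + q * u2 + r * v1 + s * (u2 * v1) = 0" "p + q * u2 + r * v2 + s * (u2 * v2) = 0"
    and "u1 \<noteq> u2" "v1 \<noteq> v2"
  shows "p = 0" "q = 0" "r = 0" "s = 0"
proof -
  have "(v1 - v2) * (r + s * u1) = 0" "(v1 - v2) * (r + s * u2) = 0"
    using assms(1-4) by (simp_all add: algebra_simps)
  then have rs: "r + s * u1 = 0" "r + s * u2 = 0" using assms by auto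
  then have "s * (u1 - u2) = 0" unfolding right_diff_distrib by linarith
  then show s: "s = 0" using assms by auto
  then show r: "r = 0" using rs by simp
  have "q * (u1 - u2) = 0" using assms(1,3) unfolding s r right_diff_distrib by linarith
  then show q: "q = 0" using assms by auto
  show "p = 0" using assms(1) by (simp add: q r s)
qed

lemma separated_system_exists:
  assumes \<sigma>: "\<sigma> * \<sigma> = 1" and \<epsilon>: "\<epsilon> * \<epsilon> = 1"
    and I: "open I" "convex I" "x0 \<in> I" "F x0 \<noteq> 0"
    and J: "open J" "convex J" "y0 \<in> J" "G y0 \<noteq> 0"
    and dF: "\<And>x. x \<in> I \<Longrightarrow> (F has_real_derivative F1 x) (at x)"
    and dF1: "\<And>x. x \<in> I \<Longrightarrow> (F1 has_real_derivative F2 x) (at x)"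
    and dG: "\<And>y. y \<in> J \<Longrightarrow> (G has_real_derivative G1 y) (at y)"
    and dG1: "\<And>y. y \<in> J \<Longrightarrow> (G1 has_real_derivative G2 y) (at y)"
    and pde: "\<And>x y. x \<in> I \<Longrightarrow> y \<in> J \<Longrightarrow> separated_pde \<sigma> \<epsilon> a (F x) (F1 x) (F2 x) (G y) (G1 y) (G2 y)"
  shows "\<exists>A B C. separated_system \<sigma> \<epsilon> a A B C F F1 I G G1 J"
proof -
  note pde' = separated_pde_swap[OF \<epsilon> pde]
  have \<sigma>0: "\<sigma> \<noteq> 0" using \<sigma> by auto
  \<comment> \<open>The elimination needs two different squares of each factor. If one factor is
    constant, the linear equation for the other is used, after a swap when that factor is
    \<open>F\<close>.\<close>
  consider "G constant_on J" | "F constant_on I" | "\<not> G constant_on J" "\<not> F constant_on I" by blast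
  then show ?thesis
  proof cases
    case 1
    then have "\<And>y. y \<in> J \<Longrightarrow> G y = G y0" using J unfolding constant_on_def by metis
    then show ?thesis
      using separated_system_constant_right[OF \<sigma> \<epsilon> I(2) dF dF1 J(1) _ dG dG1 pde] J by blast
  next
    case 2
    then have "\<And>x. x \<in> I \<Longrightarrow> F x = F x0" using I unfolding constant_on_def by metis
    then have "\<exists>A B C. separated_system \<sigma> \<epsilon> (- (\<epsilon> * a)) A B C G G1 J F F1 I"
      using separated_system_constant_right[OF \<sigma> \<epsilon> J(2) dG dG1 I(1) _ dF dF1 pde'] I by blast
    then show ?thesis using separated_system_swap[OF \<epsilon>] by blast
  next
    case 3
    have "continuous_on J G" "continuous_on I F"
      using dF dG by (meson DERIV_continuous_on has_field_derivative_at_within)+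
    then obtain x1 x2 y1 y2 where
      y12: "y1 \<in> J" "y2 \<in> J" "G y1 \<noteq> 0" "G y2 \<noteq> 0" "(G y1)\<^sup>2 \<noteq> (G y2)\<^sup>2"
      and x12: "x1 \<in> I" "x2 \<in> I" "F x1 \<noteq> 0" "F x2 \<noteq> 0" "(F x1)\<^sup>2 \<noteq> (F x2)\<^sup>2"
      using nonconstant_on_nonzero[OF convex_connected[OF J(2)] _ 3(1)]
        nonconstant_on_nonzero[OF convex_connected[OF I(2)] _ 3(2)] by metis
    obtain \<alpha> \<beta> where F2: "\<And>x. x \<in> I \<Longrightarrow> F2 x = 2 * \<alpha> * F x ^ 3 + \<beta> * F x"
      using cubic_from_separated_pde[where F = F and ?F1.0 = F1 and ?F2.0 = F2 and G = G and ?G1.0 = G1 and ?G2.0 = G2, OF pde \<sigma>0 y12] by blast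
    obtain \<gamma> \<eta> where G2: "\<And>y. y \<in> J \<Longrightarrow> G2 y = 2 * \<gamma> * G y ^ 3 + \<eta> * G y"
      using cubic_from_separated_pde[where F = G and ?F1.0 = G1 and ?F2.0 = G2 and G = F and ?G1.0 = F1 and ?G2.0 = F2, OF pde' \<sigma>0 x12] by blast
    have "(F1 has_real_derivative 2 * \<alpha> * F x ^ 3 + \<beta> * F x) (at x)" if "x \<in> I" for x
      using dF1[OF that] F2[OF that] by simp
    from elliptic_odeI_second_order[where F = F and F' = F1, OF I(2) dF this]
    obtain C where C: "elliptic_ode \<alpha> \<beta> C F F1 I" by blast
    have "(G1 has_real_derivative 2 * \<gamma> * G y ^ 3 + \<eta> * G y) (at y)" if "y \<in> J" for y
      using dG1[OF that] G2[OF that] by simp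
    from elliptic_odeI_second_order[where F = G and F' = G1, OF J(2) dG this]
    obtain A where A: "elliptic_ode \<gamma> \<eta> A G G1 J" by blast
    \<comment> \<open>After insertion of the cubic equations and first integrals, the terms in
      \<open>F\<^sup>4 G\<^sup>2\<close> and \<open>F\<^sup>2 G\<^sup>4\<close> cancel. What remains
      is bilinear in \<open>F\<^sup>2\<close> and \<open>G\<^sup>2\<close> and vanishes on a
      two-by-two grid, so its coefficients are zero.\<close>
    have rel: "(\<beta> - \<epsilon> * \<eta> - 4 * a) + 2 * (\<alpha> - \<sigma> * \<epsilon> * A) * (F x)\<^sup>2 + 2 * (\<sigma> * C - \<epsilon> * \<gamma>) * (G y)\<^sup>2
        + \<sigma> * (\<beta> - \<epsilon> * \<eta> - 4 * a) * ((F x)\<^sup>2 * (G y)\<^sup>2) = 0"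
      if "x \<in> I" "y \<in> J" "F x \<noteq> 0" "G y \<noteq> 0" for x y
    proof -
      have F1: "(F1 x)\<^sup>2 = \<alpha> * F x ^ 4 + \<beta> * (F x)\<^sup>2 + C" and G1: "(G1 y)\<^sup>2 = \<gamma> * G y ^ 4 + \<eta> * (G y)\<^sup>2 + A"
        using A C that unfolding elliptic_ode_def by blast+
      have "(1 - \<sigma> * (F x * G y)\<^sup>2) * (F2 x * G y - \<epsilon> * (F x * G2 y))
          + 2 * \<sigma> * (F x * G y) * ((F1 x)\<^sup>2 * (G y)\<^sup>2 - \<epsilon> * ((F x)\<^sup>2 * (G1 y)\<^sup>2))
          = 4 * a * (F x * G y) * (1 + \<sigma> * (F x * G y)\<^sup>2)"
        using pde[OF that(1,2)] by (simp add: separated_pde_def power_mult_distrib)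
      then have "F x * G y * ((\<beta> - \<epsilon> * \<eta> - 4 * a) + 2 * (\<alpha> - \<sigma> * \<epsilon> * A) * (F x)\<^sup>2
        + 2 * (\<sigma> * C - \<epsilon> * \<gamma>) * (G y)\<^sup>2 + \<sigma> * (\<beta> - \<epsilon> * \<eta> - 4 * a) * ((F x)\<^sup>2 * (G y)\<^sup>2)) = 0"
        unfolding F1 G1 F2[OF that(1)] G2[OF that(2)]
        by (simp add: algebra_simps eval_nat_numeral)
      then show ?thesis using that by simp
    qed
    note * = bilinear_four_points[OF rel[OF x12(1) y12(1) x12(3) y12(3)] rel[OF x12(1) y12(2) x12(3) y12(4)]
      rel[OF x12(2) y12(1) x12(4) y12(3)] rel[OF x12(2) y12(2) x12(4) y12(4)] x12(5) y12(5)]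
    have "\<epsilon> * (\<epsilon> * \<gamma>) = \<epsilon> * (\<sigma> * C)" "\<epsilon> * (\<epsilon> * \<eta>) = \<epsilon> * (\<beta> - 4 * a)"
      using *(1,3) by simp_all
    then have "\<gamma> = \<sigma> * \<epsilon> * C" "\<eta> = \<epsilon> * (\<beta> - 4 * a)"
      using \<epsilon> unfolding mult.assoc[symmetric] by (simp_all add: mult.commute)
    moreover have "\<alpha> = \<sigma> * \<epsilon> * A" using *(2) by simp
    ultimately show ?thesis using A C unfolding separated_system_def by blast
  qed
qed

section \<open>From the equation for \<open>w\<close> to the separated equation\<close>

text \<open>The regularity of a factor is inherited from \<open>w\<close>: along a line where the
  other factor has the nonzero value \<open>k\<close>, \<open>F\<close> equals
  \<open>\<tau> (v s) / k\<close>. Its derivative is an expression in \<open>F\<close> and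
  \<open>v1\<close>, which can be differentiated once more.\<close>

lemma inner_derivatives_from_composition:
  fixes \<tau> v v1 v2 F :: "real \<Rightarrow> real"
  assumes "open X" "s \<in> X" "k \<noteq> 0"
    and dv: "\<And>s. s \<in> X \<Longrightarrow> (v has_real_derivative v1 s) (at s)"
    and dv1: "\<And>s. s \<in> X \<Longrightarrow> (v1 has_real_derivative v2 s) (at s)"
    and d\<tau>: "\<And>s. s \<in> X \<Longrightarrow> (\<tau> has_real_derivative (1 - \<sigma> * (\<tau> (v s))\<^sup>2) / 2) (at (v s))"
    and eq: "\<And>s. s \<in> X \<Longrightarrow> \<tau> (v s) = k * F s"
  shows "F differentiable (at s)" "deriv F differentiable (at s)"
proof -
  have dF: "(F has_real_derivative (1 - \<sigma> * (k * F s)\<^sup>2) / 2 * v1 s / k) (at s)" if "s \<in> X" for s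
  proof (rule has_field_derivative_transform_within_open[where f = "\<lambda>s. \<tau> (v s) / k" and S = X])
    show "((\<lambda>s. \<tau> (v s) / k) has_real_derivative (1 - \<sigma> * (k * F s)\<^sup>2) / 2 * v1 s / k) (at s)"
      using DERIV_chain2[OF d\<tau>[OF that] dv[OF that]] unfolding eq[OF that]
      by (rule DERIV_cdivide)
  qed (use assms that in auto)
  then show F: "F differentiable (at s)" using \<open>s \<in> X\<close> real_differentiable_def by blast
  have eq': "deriv F s = (1 - \<sigma> * (k * F s)\<^sup>2) / 2 * v1 s / k" if "s \<in> X" for s
    by (rule DERIV_imp_deriv[OF dF[OF that]])
  have "((\<lambda>s. (1 - \<sigma> * (k * F s)\<^sup>2) / 2 * v1 s / k) has_real_derivative
      ((1 - \<sigma> * (k * F s)\<^sup>2) * v2 s - 2 * \<sigma> * k\<^sup>2 * F s * deriv F s * v1 s) / (2 * k)) (at s)"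
    using dF[OF \<open>s \<in> X\<close>, folded eq'[OF \<open>s \<in> X\<close>]] dv1[OF \<open>s \<in> X\<close>] \<open>k \<noteq> 0\<close>
    by (auto intro!: derivative_eq_intros simp: field_simps power2_eq_square)
  then have "(deriv F has_real_derivative
      ((1 - \<sigma> * (k * F s)\<^sup>2) * v2 s - 2 * \<sigma> * k\<^sup>2 * F s * deriv F s * v1 s) / (2 * k)) (at s)"
    by (rule has_field_derivative_transform_within_open[where S = X]) (use assms eq' in auto)
  then show "deriv F differentiable (at s)" using real_differentiable_def by blast
qed

text \<open>Here \<open>k\<close> may be 0. The relations are not divided by it, so they hold on
  every line of a rectangle, including those where the other factor vanishes.\<close>

lemma outer_derivatives_from_composition:
  fixes \<tau> v v1 v2 F F1 F2 :: "real \<Rightarrow> real"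
  assumes "open X" "s \<in> X"
    and dv: "\<And>s. s \<in> X \<Longrightarrow> (v has_real_derivative v1 s) (at s)"
    and dv1: "\<And>s. s \<in> X \<Longrightarrow> (v1 has_real_derivative v2 s) (at s)"
    and d\<tau>: "\<And>s. s \<in> X \<Longrightarrow> (\<tau> has_real_derivative (1 - \<sigma> * (\<tau> (v s))\<^sup>2) / 2) (at (v s))"
    and eq: "\<And>s. s \<in> X \<Longrightarrow> \<tau> (v s) = k * F s"
    and dF: "\<And>s. s \<in> X \<Longrightarrow> (F has_real_derivative F1 s) (at s)"
    and dF1: "\<And>s. s \<in> X \<Longrightarrow> (F1 has_real_derivative F2 s) (at s)"
  shows "2 * k * F1 s = (1 - \<sigma> * (k * F s)\<^sup>2) * v1 s"
    and "2 * k * F2 s = (1 - \<sigma> * (k * F s)\<^sup>2) * v2 s - 2 * \<sigma> * k\<^sup>2 * F s * F1 s * v1 s"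
proof -
  have first: "2 * k * F1 s = (1 - \<sigma> * (k * F s)\<^sup>2) * v1 s" if "s \<in> X" for s
  proof -
    have "((\<lambda>s. k * F s) has_real_derivative (1 - \<sigma> * (k * F s)\<^sup>2) / 2 * v1 s) (at s)"
      using DERIV_chain2[OF d\<tau>[OF that] dv[OF that]] unfolding eq[OF that]
      by (rule has_field_derivative_transform_within_open[where S = X]) (use assms(1) that eq in auto)
    moreover have "((\<lambda>s. k * F s) has_real_derivative k * F1 s) (at s)"
      by (rule DERIV_cmult[OF dF[OF that]])
    ultimately show ?thesis using DERIV_unique by fastforce
  qed
  then show "2 * k * F1 s = (1 - \<sigma> * (k * F s)\<^sup>2) * v1 s" using \<open>s \<in> X\<close> .
  have "((\<lambda>s. (1 - \<sigma> * (k * F s)\<^sup>2) * v1 s) has_real_derivative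
      (1 - \<sigma> * (k * F s)\<^sup>2) * v2 s - 2 * \<sigma> * k\<^sup>2 * F s * F1 s * v1 s) (at s)"
    using dF[OF \<open>s \<in> X\<close>] dv1[OF \<open>s \<in> X\<close>]
    by (auto intro!: derivative_eq_intros simp: algebra_simps power2_eq_square)
  then have "((\<lambda>s. 2 * k * F1 s) has_real_derivative
      (1 - \<sigma> * (k * F s)\<^sup>2) * v2 s - 2 * \<sigma> * k\<^sup>2 * F s * F1 s * v1 s) (at s)"
    by (rule has_field_derivative_transform_within_open[where S = X]) (use assms(1,2) first in auto)
  moreover have "((\<lambda>s. 2 * k * F1 s) has_real_derivative 2 * k * F2 s) (at s)"
    by (rule DERIV_cmult[OF dF1[OF \<open>s \<in> X\<close>]])
  ultimately show "2 * k * F2 s = (1 - \<sigma> * (k * F s)\<^sup>2) * v2 s - 2 * \<sigma> * k\<^sup>2 * F s * F1 s * v1 s"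
    using DERIV_unique by blast
qed

lemma separated_pdeI:
  fixes \<sigma> \<epsilon> a f f1 f2 g g1 g2 :: real
  defines "m \<equiv> 1 - \<sigma> * (f * g)\<^sup>2"
  assumes m: "m \<noteq> 0"
    and x: "2 * g * f1 = m * wx" "2 * g * f2 = m * wxx - 2 * \<sigma> * g\<^sup>2 * f * f1 * wx"
    and y: "2 * f * g1 = m * wy" "2 * f * g2 = m * wyy - 2 * \<sigma> * f\<^sup>2 * g * g1 * wy"
    and pde: "wxx - \<epsilon> * wyy = 8 * a * (f * g) * (1 + \<sigma> * (f * g)\<^sup>2) / m\<^sup>2"
  shows "separated_pde \<sigma> \<epsilon> a f f1 f2 g g1 g2"
proof -
  \<comment> \<open>A second factor \<open>m\<close> lets the remaining \<open>wx\<close> occur only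
    as \<open>m * wx\<close>, which the first-order relation replaces.\<close>
  have "m * (m * wxx) = m * (2 * g * f2) + 2 * \<sigma> * g\<^sup>2 * f * f1 * (m * wx)"
    unfolding x(2) by (simp add: algebra_simps)
  then have xx: "m * (m * wxx) = 2 * m * (g * f2) + 4 * \<sigma> * (f * g) * (f1 * g)\<^sup>2"
    unfolding x(1)[symmetric] by (simp add: algebra_simps power2_eq_square)
  have "m * (m * wyy) = m * (2 * f * g2) + 2 * \<sigma> * f\<^sup>2 * g * g1 * (m * wy)"
    unfolding y(2) by (simp add: algebra_simps)
  then have yy: "m * (m * wyy) = 2 * m * (f * g2) + 4 * \<sigma> * (f * g) * (f * g1)\<^sup>2"
    unfolding y(1)[symmetric] by (simp add: algebra_simps power2_eq_square)
  have "m * (m * wxx) - \<epsilon> * (m * (m * wyy)) = 8 * a * (f * g) * (1 + \<sigma> * (f * g)\<^sup>2)"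
    using pde m by (simp add: field_simps power2_eq_square)
  then show ?thesis
    using m unfolding xx yy separated_pde_def m_def[symmetric] by (simp add: algebra_simps)
qed

text \<open>Both values of \<open>\<kappa>\<close> are treated at once: \<open>sn\<close> and
  \<open>cn\<close> are the hyperbolic or the circular sine and cosine of \<open>v / 2\<close>, and
  \<open>\<sigma>\<close> is the sign that distinguishes their identities.\<close>

lemma real_sinh_cosh_components:
  assumes "\<kappa> \<in> {1, \<i>}"
  obtains \<sigma> :: real and sn cn :: "real \<Rightarrow> real" where
    "\<sigma> * \<sigma> = 1" "\<kappa>\<^sup>2 = of_real \<sigma>"
    "\<And>v. sinh (\<kappa> * of_real v / 2) = \<kappa> * of_real (sn v)" "\<And>v. cosh (\<kappa> * of_real v / 2) = of_real (cn v)"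
    "\<And>v. (cn v)\<^sup>2 - \<sigma> * (sn v)\<^sup>2 = 1"
    "\<And>v. (sn has_real_derivative cn v / 2) (at v)" "\<And>v. (cn has_real_derivative \<sigma> * sn v / 2) (at v)"
proof (cases "\<kappa> = 1")
  case True
  show ?thesis
  proof (rule that[of 1 "\<lambda>v. sinh (v / 2)" "\<lambda>v. cosh (v / 2)"])
    show "sinh (\<kappa> * of_real v / 2) = \<kappa> * of_real (sinh (v / 2))" for v
      using exp_of_real[of "v / 2", where 'a = complex] exp_of_real[of "- (v / 2)", where 'a = complex]
      by (simp add: True sinh_field_def)
    show "cosh (\<kappa> * of_real v / 2) = of_real (cosh (v / 2))" for v
      using exp_of_real[of "v / 2", where 'a = complex] exp_of_real[of "- (v / 2)", where 'a = complex]
      by (simp add: True cosh_field_def)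
  qed (auto simp: True cosh_square_eq intro!: derivative_eq_intros)
next
  case False
  then have \<kappa>: "\<kappa> = \<i>" using assms by simp
  show ?thesis
  proof (rule that[of "-1" "\<lambda>v. sin (v / 2)" "\<lambda>v. cos (v / 2)"])
    show "sinh (\<kappa> * of_real v / 2) = \<kappa> * of_real (sin (v / 2))" for v
      unfolding sin_of_real[symmetric] of_real_divide sin_conv_sinh \<kappa> by simp
    show "cosh (\<kappa> * of_real v / 2) = of_real (cos (v / 2))" for v
      unfolding cos_of_real[symmetric] of_real_divide cos_conv_cosh \<kappa> by simp
  qed (auto simp: \<kappa> intro!: derivative_eq_intros)
qed

text \<open>With \<open>\<tau> = sn / cn\<close>, a hyperbolic or circular half-angle tangent, every
  complex quantity in the problem becomes real. All facts follow from
  \<open>1 - \<sigma> * \<tau>\<^sup>2\<close> being the inverse square of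
  \<open>cn\<close>.\<close>

lemma real_half_tanh:
  assumes \<kappa>: "\<kappa> \<in> {1, \<i>}"
  obtains \<sigma> :: real and \<tau> :: "real \<Rightarrow> real" where
    "\<sigma> * \<sigma> = 1" "\<kappa>\<^sup>2 = of_real \<sigma>"
    "\<And>v. cosh (\<kappa> * of_real v / 2) \<noteq> 0 \<Longrightarrow> tanh (\<kappa> * of_real v / 2) = \<kappa> * of_real (\<tau> v)"
    "\<And>v. cosh (\<kappa> * of_real v / 2) \<noteq> 0 \<Longrightarrow> 1 - \<sigma> * (\<tau> v)\<^sup>2 \<noteq> 0"
    "\<And>v. cosh (\<kappa> * of_real v / 2) \<noteq> 0 \<Longrightarrow> (\<tau> has_real_derivative (1 - \<sigma> * (\<tau> v)\<^sup>2) / 2) (at v)"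
    "\<And>v a. cosh (\<kappa> * of_real v / 2) \<noteq> 0 \<Longrightarrow> 2 * of_real a / \<kappa> * sinh (2 * \<kappa> * of_real v)
      = of_real (8 * a * \<tau> v * (1 + \<sigma> * (\<tau> v)\<^sup>2) / (1 - \<sigma> * (\<tau> v)\<^sup>2)\<^sup>2)"
proof -
  from real_sinh_cosh_components[OF \<kappa>] obtain \<sigma> :: real and sn cn :: "real \<Rightarrow> real" where
    \<sigma>: "\<sigma> * \<sigma> = 1" "\<kappa>\<^sup>2 = of_real \<sigma>"
    and sn: "\<And>v. sinh (\<kappa> * of_real v / 2) = \<kappa> * of_real (sn v)"
    and cn: "\<And>v. cosh (\<kappa> * of_real v / 2) = of_real (cn v)"
    and id: "\<And>v. (cn v)\<^sup>2 - \<sigma> * (sn v)\<^sup>2 = 1"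
    and d: "\<And>v. (sn has_real_derivative cn v / 2) (at v)" "\<And>v. (cn has_real_derivative \<sigma> * sn v / 2) (at v)"
    by metis
  have \<kappa>0: "\<kappa> \<noteq> 0" using \<kappa> by auto
  have m: "1 - \<sigma> * (sn v / cn v)\<^sup>2 = 1 / (cn v)\<^sup>2" if "cn v \<noteq> 0" for v
  proof -
    have "1 - \<sigma> * (sn v / cn v)\<^sup>2 = ((cn v)\<^sup>2 - \<sigma> * (sn v)\<^sup>2) / (cn v)\<^sup>2"
      by (simp add: power_divide diff_divide_distrib that)
    then show ?thesis by (simp add: id)
  qed
  show ?thesis
  proof (rule that[of \<sigma> "\<lambda>v. sn v / cn v", OF \<sigma>])
    fix v assume "cosh (\<kappa> * of_real v / 2) \<noteq> 0"
    then have c0: "cn v \<noteq> 0" by (simp add: cn)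
    show "tanh (\<kappa> * of_real v / 2) = \<kappa> * of_real (sn v / cn v)"
      by (simp add: tanh_def sn cn)
    show "1 - \<sigma> * (sn v / cn v)\<^sup>2 \<noteq> 0" using m[OF c0] c0 by simp
    have "((\<lambda>v. sn v / cn v) has_real_derivative
        (cn v / 2 * cn v - sn v * (\<sigma> * sn v / 2)) / (cn v * cn v)) (at v)"
      using d c0 by (intro DERIV_divide) auto
    moreover have "(cn v / 2 * cn v - sn v * (\<sigma> * sn v / 2)) / (cn v * cn v) = (1 - \<sigma> * (sn v / cn v)\<^sup>2) / 2"
      unfolding m[OF c0] using id[of v] c0 by (simp add: field_simps power2_eq_square)
    ultimately show "((\<lambda>v. sn v / cn v) has_real_derivative (1 - \<sigma> * (sn v / cn v)\<^sup>2) / 2) (at v)"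
      by (simp only:)
    fix a :: real
    let ?h = "\<kappa> * of_real v / 2"
    \<comment> \<open>The argument \<open>2 * \<kappa> * v\<close> is four times the half argument,
      so the double-angle formulas are used twice.\<close>
    have "sinh (2 * (2 * ?h)) = 4 * (\<kappa> * of_real (sn v)) * of_real (cn v)
        * ((of_real (cn v))\<^sup>2 + \<kappa>\<^sup>2 * (of_real (sn v))\<^sup>2)"
      unfolding sinh_double[of "2 * ?h"] sinh_double[of ?h] cosh_double[of ?h] sn cn
      by (simp add: power_mult_distrib)
    then have "2 * of_real a / \<kappa> * sinh (2 * \<kappa> * of_real v)
        = of_real (8 * a * sn v * cn v * ((cn v)\<^sup>2 + \<sigma> * (sn v)\<^sup>2))"
      using \<kappa>0 by (simp add: \<sigma> mult.assoc)
    also have "8 * a * sn v * cn v * ((cn v)\<^sup>2 + \<sigma> * (sn v)\<^sup>2)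
        = 8 * a * (sn v / cn v) * (1 + \<sigma> * (sn v / cn v)\<^sup>2) / (1 - \<sigma> * (sn v / cn v)\<^sup>2)\<^sup>2"
      unfolding m[OF c0] using c0 by (simp add: field_simps power2_eq_square)
    finally show "2 * of_real a / \<kappa> * sinh (2 * \<kappa> * of_real v)
      = of_real (8 * a * (sn v / cn v) * (1 + \<sigma> * (sn v / cn v)\<^sup>2) / (1 - \<sigma> * (sn v / cn v)\<^sup>2)\<^sup>2)" .
  qed
qed

section \<open>Propagation through a connected open set\<close>

text \<open>Products let the two variables range independently, as separation requires. Empty sides
  are allowed, which keeps the notion closed under intersection.\<close>

definition rectangle_in :: "(real \<times> real) set \<Rightarrow> real set \<Rightarrow> real set \<Rightarrow> bool" where
  "rectangle_in \<Omega> I J \<longleftrightarrow> open I \<and> convex I \<and> open J \<and> convex J \<and> I \<times> J \<subseteq> \<Omega>"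

lemma rectangle_in_Int:
  "rectangle_in \<Omega> I J \<Longrightarrow> rectangle_in \<Omega> I' J' \<Longrightarrow> rectangle_in \<Omega> (I \<inter> I') (J \<inter> J')"
  unfolding rectangle_in_def by (auto intro: convex_Int)

lemma rectangle_in_exists:
  assumes "open \<Omega>" "(x, y) \<in> \<Omega>"
  obtains I J where "rectangle_in \<Omega> I J" "x \<in> I" "y \<in> J"
proof -
  obtain A B where AB: "open A" "open B" "(x, y) \<in> A \<times> B" "A \<times> B \<subseteq> \<Omega>"
    using open_prod_elim[OF assms] by blast
  then obtain r s where "r > 0" "ball x r \<subseteq> A" "s > 0" "ball y s \<subseteq> B"
    by (metis openE mem_Sigma_iff)
  with AB show ?thesis
    by (intro that[of "ball x r" "ball y s"]) (auto simp: rectangle_in_def)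
qed

text \<open>Each point has a rectangle around it that lies in \<open>S\<close> or misses
  \<open>S\<close>, so \<open>S\<close> and its complement in \<open>\<Omega>\<close> are both
  open.\<close>

lemma rectangle_propagation:
  assumes \<Omega>: "open \<Omega>" "connected \<Omega>" and S: "S \<subseteq> \<Omega>" "S \<noteq> {}"
    and step: "\<And>I J. rectangle_in \<Omega> I J \<Longrightarrow> (I \<times> J) \<inter> S \<noteq> {} \<Longrightarrow> I \<times> J \<subseteq> S"
  shows "S = \<Omega>"
proof -
  have nbhd: "\<exists>T. open T \<and> p \<in> T \<and> T \<subseteq> \<Omega> \<and> (T \<subseteq> S \<or> T \<inter> S = {})" if p: "p \<in> \<Omega>" for p
  proof -
    obtain I J where "rectangle_in \<Omega> I J" "fst p \<in> I" "snd p \<in> J"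
      using rectangle_in_exists[OF \<Omega>(1), of "fst p" "snd p"] p by auto
    then show ?thesis
      using step[of I J] by (intro exI[of _ "I \<times> J"]) (auto simp: rectangle_in_def open_Times mem_Times_iff)
  qed
  have "open S"
    unfolding open_subopen[of S] using nbhd S(1) by (metis disjoint_iff subsetD)
  moreover have "open (\<Omega> - S)"
    unfolding open_subopen[of "\<Omega> - S"]
  proof
    fix p assume p: "p \<in> \<Omega> - S"
    then obtain T where "open T" "p \<in> T" "T \<subseteq> \<Omega>" "T \<subseteq> S \<or> T \<inter> S = {}" using nbhd by blast
    with p show "\<exists>T. open T \<and> p \<in> T \<and> T \<subseteq> \<Omega> - S" by (intro exI[of _ T]) blast
  qed
  ultimately have "S \<inter> \<Omega> = {} \<or> (\<Omega> - S) \<inter> \<Omega> = {}"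
    by (intro connectedD[OF \<Omega>(2)]) auto
  then show ?thesis using S by blast
qed

section \<open>Constant solutions on overlapping intervals\<close>

lemma elliptic_ode_subset: "elliptic_ode \<alpha> \<beta> \<gamma> F F' I \<Longrightarrow> I' \<subseteq> I \<Longrightarrow> elliptic_ode \<alpha> \<beta> \<gamma> F F' I'"
  unfolding elliptic_ode_def by blast

lemma elliptic_ode_constant_on:
  assumes "elliptic_ode \<alpha> \<beta> \<gamma> F F' I" "convex I" "open I'" "I' \<noteq> {}" "I' \<subseteq> I" "F constant_on I'"
  shows "F constant_on I"
  by (rule cubic_ode_constant_on[where F = F and F' = F' and \<alpha> = \<alpha> and \<beta> = \<beta>,
        OF assms(2) _ _ assms(3-6)])
    (use assms(1) in \<open>simp_all add: elliptic_ode_def\<close>)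

lemma elliptic_ode_equal_on:
  assumes "elliptic_ode \<alpha> \<beta> \<gamma> F F' I" "convex I" "open I" "open I'" "x \<in> I \<inter> I'"
    and "\<And>z. z \<in> I' \<Longrightarrow> F z = c" "z \<in> I"
  shows "F z = c"
proof -
  have "F constant_on I \<inter> I'" using assms(6) unfolding constant_on_def by blast
  then have "F constant_on I"
    by (rule elliptic_ode_constant_on[OF assms(1,2), rotated 3]) (use assms in auto)
  then show ?thesis using assms(5,6,7) unfolding constant_on_def by (metis Int_iff)
qed

text \<open>For a constant solution the three conditions become \<open>F' = 0\<close> and two
  algebraic equations for \<open>c\<close>, which do not refer to the interval.\<close>

lemma elliptic_ode_transfer_constant:
  assumes ode: "elliptic_ode \<alpha> \<beta> \<gamma> F F' I" "elliptic_ode \<alpha>' \<beta>' \<gamma>' F F' I'"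
    and "open I" "open I'" "x \<in> I"
    and c: "\<And>z. z \<in> I \<Longrightarrow> F z = c" "\<And>z. z \<in> I' \<Longrightarrow> F z = c"
  shows "elliptic_ode \<alpha> \<beta> \<gamma> F F' I'"
proof -
  have ode_c: "F' z = 0 \<and> 2 * \<alpha>'' * c ^ 3 + \<beta>'' * c = 0"
    if "z \<in> K" "open K" and cK: "\<And>z. z \<in> K \<Longrightarrow> F z = c" and K: "elliptic_ode \<alpha>'' \<beta>'' \<gamma>'' F F' K"
    for z K \<alpha>'' \<beta>'' \<gamma>''
  proof -
    have F': "F' z = 0" if "z \<in> K" for z
      by (rule DERIV_zero_if_locally_constant[where F = F, OF \<open>open K\<close> that cK])
        (use K that in \<open>simp_all add: elliptic_ode_def\<close>)
    moreover have "2 * \<alpha>'' * F z ^ 3 + \<beta>'' * F z = 0"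
      by (rule DERIV_zero_if_locally_constant[where F = F', OF \<open>open K\<close> \<open>z \<in> K\<close> F'])
        (use K \<open>z \<in> K\<close> in \<open>simp_all add: elliptic_ode_def\<close>)
    ultimately show ?thesis using \<open>z \<in> K\<close> cK by simp
  qed
  have "F' x = 0" and eq: "2 * \<alpha> * c ^ 3 + \<beta> * c = 0"
    using ode_c[OF \<open>x \<in> I\<close> \<open>open I\<close> c(1) ode(1)] by simp_all
  moreover have "(F' x)\<^sup>2 = \<alpha> * F x ^ 4 + \<beta> * (F x)\<^sup>2 + \<gamma>"
    using ode(1) \<open>x \<in> I\<close> by (simp add: elliptic_ode_def)
  ultimately have first: "\<alpha> * c ^ 4 + \<beta> * c\<^sup>2 + \<gamma> = 0" using c(1)[OF \<open>x \<in> I\<close>] by simp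
  show ?thesis
    unfolding elliptic_ode_def
  proof
    fix z assume z: "z \<in> I'"
    have "F' z = 0" "2 * \<alpha>' * c ^ 3 + \<beta>' * c = 0"
      using ode_c[OF z \<open>open I'\<close> c(2) ode(2)] by simp_all
    moreover have "(F has_real_derivative F' z) (at z)"
      "(F' has_real_derivative 2 * \<alpha>' * F z ^ 3 + \<beta>' * F z) (at z)"
      using ode(2) z unfolding elliptic_ode_def by blast+
    ultimately show "(F has_real_derivative F' z) (at z)
        \<and> (F' has_real_derivative 2 * \<alpha> * F z ^ 3 + \<beta> * F z) (at z)
        \<and> (F' z)\<^sup>2 = \<alpha> * F z ^ 4 + \<beta> * (F z)\<^sup>2 + \<gamma>"
      using c(2)[OF z] eq first by simp
  qed
qed

text \<open>Constants valid on one rectangle are carried along \<open>\<Omega>\<close>. They are determined by every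
  rectangle on which \<open>F\<close> or \<open>G\<close> is not constant; if both are constant somewhere,
  they are constant throughout.\<close>

lemma separated_system_global:
  assumes "\<sigma> \<noteq> 0" "\<epsilon> \<noteq> 0" and \<Omega>: "open \<Omega>" "connected \<Omega>"
    and nonzero: "(x0, y0) \<in> \<Omega>" "F x0 \<noteq> 0" "G y0 \<noteq> 0"
    and rect: "\<And>I J x y. rectangle_in \<Omega> I J \<Longrightarrow> x \<in> I \<Longrightarrow> y \<in> J \<Longrightarrow> F x \<noteq> 0 \<Longrightarrow> G y \<noteq> 0 \<Longrightarrow>
      \<exists>A B C. separated_system \<sigma> \<epsilon> a A B C F F' I G G' J"
  shows "\<exists>A B C. separated_system \<sigma> \<epsilon> a A B C F F' (fst ` \<Omega>) G G' (snd ` \<Omega>)"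
proof -
  let ?sys = "\<lambda>A B C I J. separated_system \<sigma> \<epsilon> a A B C F F' I G G' J"
  \<comment> \<open>The equations are conditions at single points, so it suffices to cover
    \<open>\<Omega>\<close> by sets carrying the same constants, whatever the shape of the two
    projections.\<close>
  have pointwise: "?sys A B C (fst ` \<Omega>) (snd ` \<Omega>)"
    if "\<And>x y. (x, y) \<in> \<Omega> \<Longrightarrow> \<exists>I J. x \<in> I \<and> y \<in> J \<and> ?sys A B C I J" for A B C
    using that unfolding separated_system_def elliptic_ode_def by fastforce
  \<comment> \<open>The first propagation shows that neither factor vanishes identically on a side
    of any nonempty rectangle, which makes \<open>rect\<close> applicable to all of them.\<close>
  define N where "N = {p \<in> \<Omega>. \<forall>I J. rectangle_in \<Omega> I J \<longrightarrow> p \<in> I \<times> J \<longrightarrow>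
    (\<exists>x\<in>I. F x \<noteq> 0) \<and> (\<exists>y\<in>J. G y \<noteq> 0)}"
  have "N = \<Omega>"
  proof (rule rectangle_propagation[OF \<Omega>])
    show "N \<subseteq> \<Omega>" "N \<noteq> {}" using nonzero unfolding N_def by auto
    fix I J assume IJ: "rectangle_in \<Omega> I J" "(I \<times> J) \<inter> N \<noteq> {}"
    then obtain x y where xy: "x \<in> I" "y \<in> J" "F x \<noteq> 0" "G y \<noteq> 0" unfolding N_def by blast
    then obtain A B C where "?sys A B C I J" using rect[OF IJ(1)] by blast
    then have ode: "elliptic_ode (\<sigma> * \<epsilon> * A) B C F F' I"
      "elliptic_ode (\<sigma> * \<epsilon> * C) (\<epsilon> * (B - 4 * a)) A G G' J"
      unfolding separated_system_def by blast+
    \<comment> \<open>A factor vanishing on a side of the second rectangle would vanish on the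
      overlap and hence, by \<open>elliptic_ode_equal_on\<close>, on the corresponding side of the
      first.\<close>
    have "(\<exists>x\<in>I'. F x \<noteq> 0) \<and> (\<exists>y\<in>J'. G y \<noteq> 0)"
      if IJ': "rectangle_in \<Omega> I' J'" and p: "p \<in> I \<times> J" "p \<in> I' \<times> J'" for p I' J'
    proof -
      have opn: "open I" "convex I" "open I'" "open J" "convex J" "open J'"
        using IJ(1) IJ' by (auto simp: rectangle_in_def)
      have "fst p \<in> I \<inter> I'" "snd p \<in> J \<inter> J'" using p by auto
      then show ?thesis
        using elliptic_ode_equal_on[OF ode(1) opn(2,1,3), where c = 0]
          elliptic_ode_equal_on[OF ode(2) opn(5,4,6), where c = 0] xy by metis
    qed
    moreover have "I \<times> J \<subseteq> \<Omega>" using IJ(1) by (simp add: rectangle_in_def)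
    ultimately show "I \<times> J \<subseteq> N" unfolding N_def by blast
  qed
  then have sys: "\<exists>A B C. ?sys A B C I J" if "rectangle_in \<Omega> I J" "x \<in> I" "y \<in> J" for I J x y
  proof -
    have "(x, y) \<in> N" using that \<open>N = \<Omega>\<close> by (auto simp: rectangle_in_def)
    then show ?thesis using that rect[OF that(1)] unfolding N_def by blast
  qed
  \<comment> \<open>Where both factors are constant, the triple \<open>A\<close>, \<open>B\<close>,
    \<open>C\<close> is not unique. In that case the values \<open>c\<close> and \<open>d\<close>
    are propagated instead, and any one triple is transferred afterwards.\<close>
  show ?thesis
  proof (cases "\<exists>I J x y c d. rectangle_in \<Omega> I J \<and> x \<in> I \<and> y \<in> J \<and> (\<forall>z\<in>I. F z = c) \<and> (\<forall>z\<in>J. G z = d)")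
    case True
    then obtain I J x y c d where IJ: "rectangle_in \<Omega> I J" "x \<in> I" "y \<in> J"
      "\<And>z. z \<in> I \<Longrightarrow> F z = c" "\<And>z. z \<in> J \<Longrightarrow> G z = d" by blast
    obtain A B C where ABC: "?sys A B C I J" using sys[OF IJ(1-3)] by blast
    define S where "S = {p \<in> \<Omega>. \<exists>I J. rectangle_in \<Omega> I J \<and> p \<in> I \<times> J \<and>
      (\<forall>z\<in>I. F z = c) \<and> (\<forall>z\<in>J. G z = d)}"
    have "S = \<Omega>"
    proof (rule rectangle_propagation[OF \<Omega>])
      show "S \<subseteq> \<Omega>" unfolding S_def by blast
      have "(x, y) \<in> S" using IJ unfolding S_def by (auto simp: rectangle_in_def)
      then show "S \<noteq> {}" by blast
      fix I1 J1 assume IJ1: "rectangle_in \<Omega> I1 J1" "(I1 \<times> J1) \<inter> S \<noteq> {}"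
      then obtain p I2 J2 where p: "p \<in> I1 \<times> J1" "rectangle_in \<Omega> I2 J2" "p \<in> I2 \<times> J2"
        "\<And>z. z \<in> I2 \<Longrightarrow> F z = c" "\<And>z. z \<in> J2 \<Longrightarrow> G z = d" unfolding S_def by blast
      obtain A1 B1 C1 where "?sys A1 B1 C1 I1 J1" using sys[OF IJ1(1)] p(1) by blast
      then have ode: "elliptic_ode (\<sigma> * \<epsilon> * A1) B1 C1 F F' I1"
        "elliptic_ode (\<sigma> * \<epsilon> * C1) (\<epsilon> * (B1 - 4 * a)) A1 G G' J1"
        unfolding separated_system_def by blast+
      have "F z = c" if "z \<in> I1" for z
        by (rule elliptic_ode_equal_on[OF ode(1), where I' = I2 and x = "fst p"])
          (use p IJ1 that in \<open>auto simp: rectangle_in_def\<close>)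
      moreover have "G z = d" if "z \<in> J1" for z
        by (rule elliptic_ode_equal_on[OF ode(2), where I' = J2 and x = "snd p"])
          (use p IJ1 that in \<open>auto simp: rectangle_in_def\<close>)
      moreover have "I1 \<times> J1 \<subseteq> \<Omega>" using IJ1(1) by (simp add: rectangle_in_def)
      ultimately show "I1 \<times> J1 \<subseteq> S" using IJ1(1) unfolding S_def by blast
    qed
    have "?sys A B C (fst ` \<Omega>) (snd ` \<Omega>)"
    proof (rule pointwise)
      fix x1 y1 assume "(x1, y1) \<in> \<Omega>"
      then have "(x1, y1) \<in> S" using \<open>S = \<Omega>\<close> by blast
      then obtain I1 J1 where IJ1: "rectangle_in \<Omega> I1 J1" "x1 \<in> I1" "y1 \<in> J1"
        "\<And>z. z \<in> I1 \<Longrightarrow> F z = c" "\<And>z. z \<in> J1 \<Longrightarrow> G z = d" unfolding S_def by blast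
      obtain A1 B1 C1 where ABC1: "?sys A1 B1 C1 I1 J1" using sys[OF IJ1(1-3)] by blast
      have opn: "open I" "open I1" "open J" "open J1" using IJ(1) IJ1(1) by (auto simp: rectangle_in_def)
      have "?sys A B C I1 J1"
        using ABC ABC1 elliptic_ode_transfer_constant[where F = F and F' = F', OF _ _ opn(1,2) IJ(2) IJ(4) IJ1(4)]
          elliptic_ode_transfer_constant[where F = G and F' = G', OF _ _ opn(3,4) IJ(3) IJ(5) IJ1(5)]
        unfolding separated_system_def by blast
      then show "\<exists>I J. x1 \<in> I \<and> y1 \<in> J \<and> ?sys A B C I J" using IJ1 by blast
    qed
    then show ?thesis by blast
  next
    case False
    obtain I0 J0 where IJ0: "rectangle_in \<Omega> I0 J0" "x0 \<in> I0" "y0 \<in> J0"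
      using rectangle_in_exists[OF \<Omega>(1) nonzero(1)] by blast
    obtain A B C where ABC: "?sys A B C I0 J0" using sys[OF IJ0] by blast
    define S where "S = {p \<in> \<Omega>. \<exists>I J. rectangle_in \<Omega> I J \<and> p \<in> I \<times> J \<and> ?sys A B C I J}"
    have "S = \<Omega>"
    proof (rule rectangle_propagation[OF \<Omega>])
      show "S \<subseteq> \<Omega>" unfolding S_def by blast
      show "S \<noteq> {}" using IJ0 ABC nonzero(1) unfolding S_def by blast
      fix I1 J1 assume IJ1: "rectangle_in \<Omega> I1 J1" "(I1 \<times> J1) \<inter> S \<noteq> {}"
      then obtain p I2 J2 where p: "p \<in> I1 \<times> J1" "rectangle_in \<Omega> I2 J2" "p \<in> I2 \<times> J2"
        and ABC2: "?sys A B C I2 J2" unfolding S_def by blast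
      obtain A1 B1 C1 where ABC1: "?sys A1 B1 C1 I1 J1" using sys[OF IJ1(1)] p(1) by blast
      let ?I = "I1 \<inter> I2" and ?J = "J1 \<inter> J2"
      have rect12: "rectangle_in \<Omega> ?I ?J" by (rule rectangle_in_Int[OF IJ1(1) p(2)])
      then have conn: "connected ?I" "connected ?J" by (auto simp: rectangle_in_def convex_connected)
      have odes: "elliptic_ode (\<sigma> * \<epsilon> * A) B C F F' ?I"
        "elliptic_ode (\<sigma> * \<epsilon> * A1) B1 C1 F F' ?I"
        "elliptic_ode (\<sigma> * \<epsilon> * C) (\<epsilon> * (B - 4 * a)) A G G' ?J"
        "elliptic_ode (\<sigma> * \<epsilon> * C1) (\<epsilon> * (B1 - 4 * a)) A1 G G' ?J"
        using ABC1 ABC2 unfolding separated_system_def by (auto elim: elliptic_ode_subset)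
      have "\<not> (F constant_on ?I \<and> G constant_on ?J)"
        using False rect12 p(1,3) unfolding constant_on_def by fastforce
      \<comment> \<open>Each of the two equations involves all three constants, so nonconstancy of
        either factor on the overlap identifies the whole triple.\<close>
      then have "A = A1 \<and> B = B1 \<and> C = C1"
        using elliptic_ode_unique[OF odes(1,2) conn(1)] elliptic_ode_unique[OF odes(3,4) conn(2)]
          \<open>\<sigma> \<noteq> 0\<close> \<open>\<epsilon> \<noteq> 0\<close> by auto
      moreover have "I1 \<times> J1 \<subseteq> \<Omega>" using IJ1(1) by (simp add: rectangle_in_def)
      ultimately show "I1 \<times> J1 \<subseteq> S" using IJ1(1) ABC1 unfolding S_def by blast
    qed
    have "?sys A B C (fst ` \<Omega>) (snd ` \<Omega>)"
    proof (rule pointwise)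
      fix x y assume "(x, y) \<in> \<Omega>"
      then have "(x, y) \<in> S" using \<open>S = \<Omega>\<close> by simp
      then show "\<exists>I J. x \<in> I \<and> y \<in> J \<and> ?sys A B C I J" unfolding S_def by blast
    qed
    then show ?thesis by blast
  qed
qed

section \<open>Reduction to real quantities, separation on rectangles and gluing\<close>

theorem theorem5:
  fixes \<delta> \<kappa> :: complex and a :: real
    and \<Omega> :: "(real \<times> real) set"
    and w :: "real \<Rightarrow> real \<Rightarrow> real"
    and F G :: "real \<Rightarrow> real"
  assumes "\<delta> \<in> {1, \<i>}" and "\<kappa> \<in> {1, \<i>}"
    and "open \<Omega>" and "connected \<Omega>"
    and "sinh_Gordon_solution \<delta> \<kappa> a \<Omega> w"
    and "separated_form \<kappa> \<Omega> w F G"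
  shows "\<exists>A B C :: real.
    (\<forall>x \<in> fst ` \<Omega>. F differentiable (at x) \<and>
       of_real ((deriv F x)\<^sup>2)
         = of_real A * \<kappa>\<^sup>2 * \<delta>\<^sup>2 * of_real (F x ^ 4) + of_real B * of_real ((F x)\<^sup>2) + of_real C) \<and>
    (\<forall>y \<in> snd ` \<Omega>. G differentiable (at y) \<and>
       of_real ((deriv G y)\<^sup>2)
         = \<kappa>\<^sup>2 * \<delta>\<^sup>2 * of_real C * of_real (G y ^ 4)
           + \<delta>\<^sup>2 * of_real (B - 4 * a) * of_real ((G y)\<^sup>2) + of_real A)"
proof -
  obtain \<epsilon> :: real where \<epsilon>: "\<epsilon> * \<epsilon> = 1" "\<delta>\<^sup>2 = of_real \<epsilon>"
  proof (cases "\<delta> = 1")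
    case True
    then show ?thesis by (intro that[of 1]) auto
  next
    case False
    then show ?thesis using assms(1) by (intro that[of "-1"]) auto
  qed
  from real_half_tanh[OF assms(2)]
  obtain \<sigma> :: real and \<tau> :: "real \<Rightarrow> real" where
    \<sigma>: "\<sigma> * \<sigma> = 1" "\<kappa>\<^sup>2 = of_real \<sigma>"
    and tanh: "\<And>v. cosh (\<kappa> * of_real v / 2) \<noteq> 0 \<Longrightarrow> tanh (\<kappa> * of_real v / 2) = \<kappa> * of_real (\<tau> v)"
    and \<tau>_ne: "\<And>v. cosh (\<kappa> * of_real v / 2) \<noteq> 0 \<Longrightarrow> 1 - \<sigma> * (\<tau> v)\<^sup>2 \<noteq> 0"
    and d\<tau>: "\<And>v. cosh (\<kappa> * of_real v / 2) \<noteq> 0 \<Longrightarrow>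
      (\<tau> has_real_derivative (1 - \<sigma> * (\<tau> v)\<^sup>2) / 2) (at v)"
    and rhs: "\<And>v a. cosh (\<kappa> * of_real v / 2) \<noteq> 0 \<Longrightarrow> 2 * of_real a / \<kappa> * sinh (2 * \<kappa> * of_real v)
      = of_real (8 * a * \<tau> v * (1 + \<sigma> * (\<tau> v)\<^sup>2) / (1 - \<sigma> * (\<tau> v)\<^sup>2)\<^sup>2)"
    by metis
  have \<sigma>\<epsilon>0: "\<sigma> \<noteq> 0" "\<epsilon> \<noteq> 0" using \<sigma>(1) \<epsilon>(1) by auto
  have \<kappa>0: "\<kappa> \<noteq> 0" using assms(2) by auto
  have cosh: "cosh (\<kappa> * of_real (w x y) / 2) \<noteq> 0" if "(x, y) \<in> \<Omega>" for x y
    using assms(6) that unfolding separated_form_def by blast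
  have \<tau>_w: "\<tau> (w x y) = F x * G y" if "(x, y) \<in> \<Omega>" for x y
  proof -
    have "\<kappa> * of_real (\<tau> (w x y)) = \<kappa> * of_real (F x) * of_real (G y)"
      using assms(6) that tanh[OF cosh[OF that]] unfolding separated_form_def by fastforce
    then have "(of_real (\<tau> (w x y)) :: complex) = of_real (F x * G y)" using \<kappa>0 by simp
    then show ?thesis by (simp only: of_real_eq_iff)
  qed
  have dx: "((\<lambda>s. w s y) has_real_derivative partial_x w x y) (at x)"
      "((\<lambda>s. partial_x w s y) has_real_derivative partial_x (partial_x w) x y) (at x)"
    and dy: "((\<lambda>t. w x t) has_real_derivative partial_y w x y) (at y)"
      "((\<lambda>t. partial_y w x t) has_real_derivative partial_y (partial_y w) x y) (at y)"
    and pde: "of_real (partial_x (partial_x w) x y) - \<delta>\<^sup>2 * of_real (partial_y (partial_y w) x y)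
          = 2 * of_real a / \<kappa> * sinh (2 * \<kappa> * of_real (w x y))"
    if "(x, y) \<in> \<Omega>" for x y
    using assms(5) that
    unfolding sinh_Gordon_solution_def DERIV_deriv_iff_real_differentiable[symmetric]
      partial_x_def[symmetric] partial_y_def[symmetric] by blast+
  have real_pde: "partial_x (partial_x w) x y - \<epsilon> * partial_y (partial_y w) x y
      = 8 * a * (F x * G y) * (1 + \<sigma> * (F x * G y)\<^sup>2) / (1 - \<sigma> * (F x * G y)\<^sup>2)\<^sup>2"
    if "(x, y) \<in> \<Omega>" for x y
  proof -
    have "(of_real (partial_x (partial_x w) x y - \<epsilon> * partial_y (partial_y w) x y) :: complex)
        = of_real (8 * a * (F x * G y) * (1 + \<sigma> * (F x * G y)\<^sup>2) / (1 - \<sigma> * (F x * G y)\<^sup>2)\<^sup>2)"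
      using pde[OF that] unfolding rhs[OF cosh[OF that]] \<tau>_w[OF that] \<epsilon> by simp
    then show ?thesis by (simp only: of_real_eq_iff)
  qed
  have rect: "\<exists>A B C. separated_system \<sigma> \<epsilon> a A B C F (deriv F) I G (deriv G) J"
    if IJ: "rectangle_in \<Omega> I J" and xy: "x \<in> I" "y \<in> J" "F x \<noteq> 0" "G y \<noteq> 0" for I J x y
  proof -
    have opn: "open I" "convex I" "open J" "convex J" and in\<Omega>: "\<And>s t. s \<in> I \<Longrightarrow> t \<in> J \<Longrightarrow> (s, t) \<in> \<Omega>"
      using IJ by (auto simp: rectangle_in_def)
    \<comment> \<open>The single line through \<open>y\<close>, where \<open>G y\<close> is nonzero,
      gives the regularity of \<open>F\<close> on all of \<open>I\<close>; the line through
      \<open>x\<close> does the same for \<open>G\<close>.\<close>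
    have "F differentiable (at s) \<and> deriv F differentiable (at s)" if "s \<in> I" for s
      using inner_derivatives_from_composition[where v = "\<lambda>s. w s y" and ?v1.0 = "\<lambda>s. partial_x w s y"
          and ?v2.0 = "\<lambda>s. partial_x (partial_x w) s y" and \<tau> = \<tau> and \<sigma> = \<sigma> and F = F,
          OF opn(1) that xy(4) dx[OF in\<Omega>[OF _ xy(2)]] d\<tau>[OF cosh[OF in\<Omega>[OF _ xy(2)]]]]
        \<tau>_w[OF in\<Omega>[OF _ xy(2)]] by (simp add: mult.commute)
    then have dF: "(F has_real_derivative deriv F s) (at s)"
      "(deriv F has_real_derivative deriv (deriv F) s) (at s)" if "s \<in> I" for s
      using that DERIV_deriv_iff_real_differentiable by blast+
    have "G differentiable (at t) \<and> deriv G differentiable (at t)" if "t \<in> J" for t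
      using inner_derivatives_from_composition[where v = "\<lambda>t. w x t" and ?v1.0 = "\<lambda>t. partial_y w x t"
          and ?v2.0 = "\<lambda>t. partial_y (partial_y w) x t" and \<tau> = \<tau> and \<sigma> = \<sigma> and F = G,
          OF opn(3) that xy(3) dy[OF in\<Omega>[OF xy(1)]] d\<tau>[OF cosh[OF in\<Omega>[OF xy(1)]]] \<tau>_w[OF in\<Omega>[OF xy(1)]]]
      by simp
    then have dG: "(G has_real_derivative deriv G t) (at t)"
      "(deriv G has_real_derivative deriv (deriv G) t) (at t)" if "t \<in> J" for t
      using that DERIV_deriv_iff_real_differentiable by blast+
    \<comment> \<open>At a general point of the rectangle \<open>F s\<close> or \<open>G t\<close>
      may be 0, so the undivided relations between the derivatives of the factors and of
      \<open>w\<close> are used.\<close>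
    have sep: "separated_pde \<sigma> \<epsilon> a (F s) (deriv F s) (deriv (deriv F) s) (G t) (deriv G t) (deriv (deriv G) t)"
      if st: "s \<in> I" "t \<in> J" for s t
    proof (rule separated_pdeI)
      show "1 - \<sigma> * (F s * G t)\<^sup>2 \<noteq> 0"
        using \<tau>_ne[OF cosh[OF in\<Omega>[OF st]]] \<tau>_w[OF in\<Omega>[OF st]] by simp
      have "\<And>s. s \<in> I \<Longrightarrow> \<tau> (w s t) = G t * F s"
        using \<tau>_w[OF in\<Omega>[OF _ st(2)]] by (simp add: mult.commute)
      note * = outer_derivatives_from_composition[where v = "\<lambda>s. w s t" and ?v1.0 = "\<lambda>s. partial_x w s t"
          and ?v2.0 = "\<lambda>s. partial_x (partial_x w) s t" and \<tau> = \<tau> and \<sigma> = \<sigma> and F = F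
          and ?F1.0 = "deriv F" and ?F2.0 = "deriv (deriv F)" and k = "G t",
          OF opn(1) st(1) dx[OF in\<Omega>[OF _ st(2)]] d\<tau>[OF cosh[OF in\<Omega>[OF _ st(2)]]] this dF]
      show "2 * G t * deriv F s = (1 - \<sigma> * (F s * G t)\<^sup>2) * partial_x w s t"
        using *(1) by (simp add: mult.commute)
      show "2 * G t * deriv (deriv F) s = (1 - \<sigma> * (F s * G t)\<^sup>2) * partial_x (partial_x w) s t
          - 2 * \<sigma> * (G t)\<^sup>2 * F s * deriv F s * partial_x w s t"
        using *(2) by (simp only: mult.commute[of "F s" "G t"])
      note ** = outer_derivatives_from_composition[where v = "\<lambda>t. w s t" and ?v1.0 = "\<lambda>t. partial_y w s t"
          and ?v2.0 = "\<lambda>t. partial_y (partial_y w) s t" and \<tau> = \<tau> and \<sigma> = \<sigma> and F = G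
          and ?F1.0 = "deriv G" and ?F2.0 = "deriv (deriv G)" and k = "F s",
          OF opn(3) st(2) dy[OF in\<Omega>[OF st(1)]] d\<tau>[OF cosh[OF in\<Omega>[OF st(1)]]] \<tau>_w[OF in\<Omega>[OF st(1)]] dG]
      show "2 * F s * deriv G t = (1 - \<sigma> * (F s * G t)\<^sup>2) * partial_y w s t"
        using **(1) .
      show "2 * F s * deriv (deriv G) t = (1 - \<sigma> * (F s * G t)\<^sup>2) * partial_y (partial_y w) s t
          - 2 * \<sigma> * (F s)\<^sup>2 * G t * deriv G t * partial_y w s t"
        using **(2) .
      show "partial_x (partial_x w) s t - \<epsilon> * partial_y (partial_y w) s t
          = 8 * a * (F s * G t) * (1 + \<sigma> * (F s * G t)\<^sup>2) / (1 - \<sigma> * (F s * G t)\<^sup>2)\<^sup>2"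
        by (rule real_pde[OF in\<Omega>[OF st]])
    qed
    show ?thesis
      by (rule separated_system_exists[where F = F and ?F1.0 = "deriv F" and ?F2.0 = "deriv (deriv F)"
            and G = G and ?G1.0 = "deriv G" and ?G2.0 = "deriv (deriv G)",
            OF \<sigma>(1) \<epsilon>(1) opn(1,2) xy(1,3) opn(3,4) xy(2,4) dF dG sep])
  qed
  obtain x0 y0 where nonzero: "(x0, y0) \<in> \<Omega>" "F x0 \<noteq> 0" "G y0 \<noteq> 0"
    using assms(6) unfolding separated_form_def by auto
  have "\<exists>A B C. separated_system \<sigma> \<epsilon> a A B C F (deriv F) (fst ` \<Omega>) G (deriv G) (snd ` \<Omega>)"
    by (rule separated_system_global[where F = F and F' = "deriv F" and G = G and G' = "deriv G",
          OF \<sigma>\<epsilon>0 assms(3,4) nonzero]) (rule rect)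
  then obtain A B C where
    sys: "separated_system \<sigma> \<epsilon> a A B C F (deriv F) (fst ` \<Omega>) G (deriv G) (snd ` \<Omega>)"
    by blast
  have F: "F differentiable (at x) \<and> (deriv F x)\<^sup>2 = \<sigma> * \<epsilon> * A * F x ^ 4 + B * (F x)\<^sup>2 + C"
    if "x \<in> fst ` \<Omega>" for x
    using sys that unfolding separated_system_def elliptic_ode_def real_differentiable_def by blast
  have G: "G differentiable (at y) \<and> (deriv G y)\<^sup>2
      = \<sigma> * \<epsilon> * C * G y ^ 4 + \<epsilon> * (B - 4 * a) * (G y)\<^sup>2 + A"
    if "y \<in> snd ` \<Omega>" for y
    using sys that unfolding separated_system_def elliptic_ode_def real_differentiable_def by blast
  show ?thesis
    unfolding \<sigma>(2) \<epsilon>(2)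
    by (rule exI[of _ A], rule exI[of _ B], rule exI[of _ C]) (simp add: F G mult_ac)
qed

end
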